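(* Suppose that the graph matrix $A$ is diagonalizable with eigenvalues $\lambda_j$, $j=1,\dots,p$. The zeta function $\zeta(z)=\mathrm{Tr}(|D|^{-z})$ extends to a meromorphic function on $\mathbb C$ which is invariant under the translation $z\mapsto z+\frac{2\pi i}{\log\rho}$. It is given by $$\zeta(z)=\sum_{j=1}^p\frac{C^j_{\hat{\mathcal H}}}{1-\lambda_j\rho^z}+h(z),$$ where $h$ is an entire function. In particular $\zeta$ has only simple poles, which are located at $\{\frac{\log\lambda_j+2\pi i k}{-\log\rho}:k\in\mathbb Z,\ j=1,\dots,p\}$, with residues given by $$\mathrm{Res}\Big(\zeta,\tfrac{\log\lambda_j+2\pi i k}{-\log\rho}\Big)=\frac{C^j_{\hat{\mathcal H}}\,\lambda_j}{-\log\rho}.$$ In particular, the metric dimension (the abscissa of convergence of the series defining $\zeta$) is equal to $s_0=\frac{\log\lambda_{PF}}{-\log\rho}$.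
   Context: Data. $\mathcal G=(\mathcal V,\mathcal E)$ is a finite oriented graph with source and range maps $s,r:\mathcal E\to\mathcal V$; its graph matrix $A$ has entries $A_{vw}=$ number of edges with source $v$ and range $w$, and is assumed primitive (some power of $A$ has only positive entries); $\lambda_{PF}$ is its Perron-Frobenius eigenvalue. $l^*\in\mathcal E$ is a distinguished one-edge loop. $\hat\tau:\mathcal E\to\mathcal E$ satisfies: if $r(\varepsilon)$ is the vertex of $l^*$ then $\hat\tau(\varepsilon)=l^*$; otherwise $\hat\tau(\varepsilon)$ starts at $r(\varepsilon)$ and its range is closer to the vertex of $l^*$ (combinatorial graph metric, non-loop edges having length 1 and loop edges length 0). $\hat{\mathcal H}$ is a symmetric subset of $\{(\varepsilon,\varepsilon')\in\mathcal E\times\mathcal E:\varepsilon\ne\varepsilon',\ s(\varepsilon)=s(\varepsilon')\}$; for $h=(\varepsilon,\varepsilon')\in\hat{\mathcal H}$ put $s^2(h)=s(\varepsilon)\in\mathcal V$. Finally $\rho\in(0,1)$. Spectral triple. $\Pi_n$ is the set of paths $\varepsilon_1\cdots\varepsilon_n$ of length $n$ ($r(\varepsilon_i)=s(\varepsilon_{i+1})$; $\Pi_0=\mathcal V$), and $\Pi_\infty$ the compact space of one-sided infinite paths. For $n\ge1$, $\tau:\Pi_n\to\Pi_\infty$ is $\tau(\varepsilon_1\cdots\varepsilon_n)=\varepsilon_1\cdots\varepsilon_n\hat\tau(\varepsilon_n)\hat\tau^2(\varepsilon_n)\cdots$. For $n\ge 1$, $E_n$ is the set of pairs $e=(\tau(\eta\varepsilon),\tau(\eta\varepsilon'))$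 with $\eta\in\Pi_{n-1}$ ending at $s(\varepsilon)$ and $(\varepsilon,\varepsilon')\in\hat{\mathcal H}$; $s(e)$ and $r(e)$ are the first and second components, $e^{op}$ is the reversed pair, and $E=\bigcup_{n\ge1}E_n$ (a disjoint union). The triple is $(C(\Pi_\infty),\ell^2(E),D)$ with $\pi(f)\varphi(e)=f(s(e))\varphi(e)$ and $D\varphi(e)=\rho^{-n}\varphi(e^{op})$ for $e\in E_n$. Constants. $\lambda_1=\lambda_{PF},\dots,\lambda_p$ are the distinct eigenvalues. Let $M_j$ be the algebraic multiplicity of $\lambda_j$, let $(R^{j,l})_{1\le l\le M_j}$ be a basis of right eigenvectors of $A$ for $\lambda_j$ and $(L^{j,l})$ a basis of left eigenvectors, normalized so that $R^{j,l}\cdot L^{j',l'}=\delta_{jj'}\delta_{ll'}$. Then $$C^j_{\hat{\mathcal H}}=\frac1{\lambda_j}\sum_{l=1}^{M_j}\sum_{v\in\mathcal V,\,h\in\hat{\mathcal H}}R^{j,l}_vL^{j,l}_{s^2(h)}.$$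
   Formalization: The residue is C^j/(-log rho), without the printed factor lambda_j; the poles are only the listed points with C^j nonzero; poles and residues concern lambda_j nonzero (an eigenvalue 0 contributes only to h); the metric dimension formula assumes H-hat nonempty. *)

theory Defs
  imports "HOL-Complex_Analysis.Complex_Analysis"
begin

section \<open>Oriented graphs and their matrices\<close>

text \<open>
  A finite oriented graph is given by its source and range maps between two finite types,
  the edges \<open>'e\<close> and the vertices \<open>'v\<close>; multiple edges and loops are allowed.
\<close>

definition graph_matrix :: "('e::finite \<Rightarrow> 'v::finite) \<Rightarrow> ('e \<Rightarrow> 'v) \<Rightarrow> 'a::semiring_1 ^ 'v ^ 'v" where
  "graph_matrix src rng = (\<chi> v w. of_nat (card {\<epsilon>. src \<epsilon> = v \<and> rng \<epsilon> = w}))"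

text \<open>The class-based power on \<open>'a ^ 'n ^ 'n\<close> would be entrywise, hence the iterated product.\<close>

definition primitive_matrix :: "real ^ 'n ^ 'n \<Rightarrow> bool" where
  "primitive_matrix A \<longleftrightarrow> (\<exists>k\<ge>1. \<forall>i j. (((**) A ^^ k) (mat 1)) $ i $ j > 0)"

definition diagonalizable_matrix :: "complex ^ 'n ^ 'n \<Rightarrow> bool" where
  "diagonalizable_matrix A \<longleftrightarrow>
     (\<exists>P \<Lambda> :: complex ^ 'n ^ 'n. invertible P \<and> (\<forall>i j. i \<noteq> j \<longrightarrow> \<Lambda> $ i $ j = 0) \<and> A = P ** \<Lambda> ** matrix_inv P)"

definition right_eigenspace :: "complex ^ 'n ^ 'n \<Rightarrow> complex \<Rightarrow> (complex ^ 'n) set" where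
  "right_eigenspace A \<mu> = {x. A *v x = \<mu> *s x}"

definition left_eigenspace :: "complex ^ 'n ^ 'n \<Rightarrow> complex \<Rightarrow> (complex ^ 'n) set" where
  "left_eigenspace A \<mu> = {x. x v* A = \<mu> *s x}"

definition eigenvalues :: "complex ^ 'n ^ 'n \<Rightarrow> complex set" where
  "eigenvalues A = {\<mu>. \<exists>x\<in>right_eigenspace A \<mu>. x \<noteq> 0}"

definition characteristic_poly :: "complex ^ 'n ^ 'n \<Rightarrow> complex poly" where
  "characteristic_poly A = det (\<chi> i j. (if i = j then [:0, 1:] else 0) - [:A $ i $ j:])"

definition algebraic_multiplicity :: "complex ^ 'n ^ 'n \<Rightarrow> complex \<Rightarrow> nat" where
  "algebraic_multiplicity A \<mu> = order \<mu> (characteristic_poly A)"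

text \<open>
  The positive eigenvalue which strictly dominates the modulus of every other eigenvalue;
  it exists for primitive matrices by the Perron-Frobenius theorem and is clearly unique.
\<close>

definition perron_frobenius_eigenvalue :: "complex ^ 'n ^ 'n \<Rightarrow> real" where
  "perron_frobenius_eigenvalue A =
     (THE l. l > 0 \<and> complex_of_real l \<in> eigenvalues A \<and>
             (\<forall>\<mu>\<in>eigenvalues A. \<mu> \<noteq> complex_of_real l \<longrightarrow> cmod \<mu> < l))"

definition indexed_basis_of :: "(nat \<Rightarrow> complex ^ 'n) \<Rightarrow> nat \<Rightarrow> (complex ^ 'n) set \<Rightarrow> bool" where
  "indexed_basis_of b m U \<longleftrightarrow>
     inj_on b {1..m} \<and> vec.independent (b ` {1..m}) \<and> vec.span (b ` {1..m}) = U"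

text \<open>
  The combinatorial distance: non-loop edges have length 1, and loops, having length 0,
  can be ignored. It can be taken along the orientation of the edges or, symmetrically,
  regardless of it; the relation \<open>S\<close> of admissible unit steps is a parameter.
\<close>

definition steps :: "('e \<Rightarrow> 'v) \<Rightarrow> ('e \<Rightarrow> 'v) \<Rightarrow> ('v \<times> 'v) set" where
  "steps src rng = {(src \<epsilon>, rng \<epsilon>) |\<epsilon>. src \<epsilon> \<noteq> rng \<epsilon>}"

definition step_dist :: "('v \<times> 'v) set \<Rightarrow> 'v \<Rightarrow> 'v \<Rightarrow> nat" where
  "step_dist S v w = (LEAST n. (v, w) \<in> S ^^ n)"

section \<open>Paths and horizontal edges\<close>

definition is_path :: "('e \<Rightarrow> 'v) \<Rightarrow> ('e \<Rightarrow> 'v) \<Rightarrow> 'e list \<Rightarrow> bool" where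
  "is_path src rng p \<longleftrightarrow> successively (\<lambda>\<epsilon> \<epsilon>'. rng \<epsilon> = src \<epsilon>') p"

definition tau :: "('e \<Rightarrow> 'e) \<Rightarrow> 'e list \<Rightarrow> (nat \<Rightarrow> 'e)" where
  "tau tauhat p i = (if i < length p then p ! i else (tauhat ^^ (Suc i - length p)) (last p))"

text \<open>
  For \<open>n = 1\<close> the path \<open>\<eta>\<close> has length 0, i.e. it is a vertex, and ending at \<open>src \<epsilon>\<close> determines
  it; so it is represented by the empty list and \<open>\<eta> @ [\<epsilon>]\<close> being a path expresses that
  \<open>\<eta>\<close> is a path ending at \<open>src \<epsilon>\<close> for all \<open>n \<ge> 1\<close>.
\<close>

definition E_level ::
    "('e \<Rightarrow> 'v) \<Rightarrow> ('e \<Rightarrow> 'v) \<Rightarrow> ('e \<Rightarrow> 'e) \<Rightarrow> ('e \<times> 'e) set \<Rightarrow> nat \<Rightarrow> ((nat \<Rightarrow> 'e) \<times> (nat \<Rightarrow> 'e)) set" where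
  "E_level src rng tauhat H n =
     {(tau tauhat (\<eta> @ [\<epsilon>]), tau tauhat (\<eta> @ [\<epsilon>'])) |\<eta> \<epsilon> \<epsilon>'.
        length \<eta> = n - 1 \<and> is_path src rng (\<eta> @ [\<epsilon>]) \<and> (\<epsilon>, \<epsilon>') \<in> H}"

definition E_all ::
    "('e \<Rightarrow> 'v) \<Rightarrow> ('e \<Rightarrow> 'v) \<Rightarrow> ('e \<Rightarrow> 'e) \<Rightarrow> ('e \<times> 'e) set \<Rightarrow> ((nat \<Rightarrow> 'e) \<times> (nat \<Rightarrow> 'e)) set" where
  "E_all src rng tauhat H = (\<Union>n\<in>{1..}. E_level src rng tauhat H n)"

definition level ::
    "('e \<Rightarrow> 'v) \<Rightarrow> ('e \<Rightarrow> 'v) \<Rightarrow> ('e \<Rightarrow> 'e) \<Rightarrow> ('e \<times> 'e) set \<Rightarrow> (nat \<Rightarrow> 'e) \<times> (nat \<Rightarrow> 'e) \<Rightarrow> nat" where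
  "level src rng tauhat H e = (THE n. n \<ge> 1 \<and> e \<in> E_level src rng tauhat H n)"

section \<open>Functions of operators on \<open>\<ell>\<^sup>2\<close> and traces\<close>

text \<open>
  Elements of \<open>\<ell>\<^sup>2(X)\<close> are functions vanishing outside \<open>X\<close>. A possibly unbounded operator is
  given by its formula on all functions; its domain consists of the elements of
  \<open>\<ell>\<^sup>2(X)\<close> that it maps into \<open>\<ell>\<^sup>2(X)\<close>.
\<close>

definition l2 :: "'x set \<Rightarrow> ('x \<Rightarrow> complex) set" where
  "l2 X = {\<phi>. (\<forall>x. x \<notin> X \<longrightarrow> \<phi> x = 0) \<and> (\<lambda>x. (cmod (\<phi> x))\<^sup>2) summable_on X}"

definition l2_inner :: "'x set \<Rightarrow> ('x \<Rightarrow> complex) \<Rightarrow> ('x \<Rightarrow> complex) \<Rightarrow> complex" where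
  "l2_inner X \<phi> \<psi> = (\<Sum>\<^sub>\<infinity>x\<in>X. cnj (\<phi> x) * \<psi> x)"

definition delta :: "'x \<Rightarrow> 'x \<Rightarrow> complex" where
  "delta x = (\<lambda>y. if y = x then 1 else 0)"

definition op_eigenspace ::
    "'x set \<Rightarrow> (('x \<Rightarrow> complex) \<Rightarrow> 'x \<Rightarrow> complex) \<Rightarrow> real \<Rightarrow> ('x \<Rightarrow> complex) set" where
  "op_eigenspace X T \<mu> = {\<phi> \<in> l2 X. T \<phi> = (\<lambda>x. complex_of_real \<mu> * \<phi> x)}"

definition point_spectrum :: "'x set \<Rightarrow> (('x \<Rightarrow> complex) \<Rightarrow> 'x \<Rightarrow> complex) \<Rightarrow> real set" where
  "point_spectrum X T = {\<mu>. \<exists>\<phi>\<in>op_eigenspace X T \<mu>. \<phi> \<noteq> (\<lambda>_. 0)}"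

definition l2_proj :: "'x set \<Rightarrow> ('x \<Rightarrow> complex) set \<Rightarrow> ('x \<Rightarrow> complex) \<Rightarrow> 'x \<Rightarrow> complex" where
  "l2_proj X K \<phi> = (THE \<psi>. \<psi> \<in> K \<and> (\<forall>\<xi>\<in>K. l2_inner X \<xi> (\<lambda>x. \<phi> x - \<psi> x) = 0))"

text \<open>
  Functional calculus \<open>f(T) = \<Sum>\<^sub>\<mu> f(\<mu>) P\<^sub>\<mu>\<close> for a self-adjoint operator \<open>T\<close> whose
  eigenvectors span \<open>\<ell>\<^sup>2(X)\<close>, where \<open>P\<^sub>\<mu>\<close> is the orthogonal projection onto the eigenspace of \<open>\<mu>\<close>.
\<close>

definition op_fun ::
    "'x set \<Rightarrow> (real \<Rightarrow> complex) \<Rightarrow> (('x \<Rightarrow> complex) \<Rightarrow> 'x \<Rightarrow> complex) \<Rightarrow> ('x \<Rightarrow> complex) \<Rightarrow> 'x \<Rightarrow> complex" where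
  "op_fun X f T \<phi> = (\<lambda>x. \<Sum>\<^sub>\<infinity>\<mu>\<in>point_spectrum X T. f \<mu> * l2_proj X (op_eigenspace X T \<mu>) \<phi> x)"

definition op_abs_cpower ::
    "'x set \<Rightarrow> (('x \<Rightarrow> complex) \<Rightarrow> 'x \<Rightarrow> complex) \<Rightarrow> complex \<Rightarrow> ('x \<Rightarrow> complex) \<Rightarrow> 'x \<Rightarrow> complex" where
  "op_abs_cpower X T w = op_fun X (\<lambda>\<mu>. complex_of_real \<bar>\<mu>\<bar> powr w) T"

definition diag_entry ::
    "'x set \<Rightarrow> (('x \<Rightarrow> complex) \<Rightarrow> 'x \<Rightarrow> complex) \<Rightarrow> 'x \<Rightarrow> complex" where
  "diag_entry X T x = l2_inner X (delta x) (T (delta x))"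

definition op_trace :: "'x set \<Rightarrow> (('x \<Rightarrow> complex) \<Rightarrow> 'x \<Rightarrow> complex) \<Rightarrow> complex" where
  "op_trace X T = (\<Sum>\<^sub>\<infinity>x\<in>X. diag_entry X T x)"

section \<open>The Dirac operator and its zeta function\<close>

definition dirac ::
    "('e \<Rightarrow> 'v) \<Rightarrow> ('e \<Rightarrow> 'v) \<Rightarrow> ('e \<Rightarrow> 'e) \<Rightarrow> ('e \<times> 'e) set \<Rightarrow> real \<Rightarrow>
     ((nat \<Rightarrow> 'e) \<times> (nat \<Rightarrow> 'e) \<Rightarrow> complex) \<Rightarrow> (nat \<Rightarrow> 'e) \<times> (nat \<Rightarrow> 'e) \<Rightarrow> complex" where
  "dirac src rng tauhat H \<rho> \<phi> e =
     (if e \<in> E_all src rng tauhat H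
      then inverse (complex_of_real \<rho>) ^ level src rng tauhat H e * \<phi> (prod.swap e)
      else 0)"

definition zeta_converges ::
    "('e \<Rightarrow> 'v) \<Rightarrow> ('e \<Rightarrow> 'v) \<Rightarrow> ('e \<Rightarrow> 'e) \<Rightarrow> ('e \<times> 'e) set \<Rightarrow> real \<Rightarrow> complex \<Rightarrow> bool" where
  "zeta_converges src rng tauhat H \<rho> z \<longleftrightarrow>
     (let E = E_all src rng tauhat H
      in diag_entry E (op_abs_cpower E (dirac src rng tauhat H \<rho>) (- z)) summable_on E)"

definition zeta_trace ::
    "('e \<Rightarrow> 'v) \<Rightarrow> ('e \<Rightarrow> 'v) \<Rightarrow> ('e \<Rightarrow> 'e) \<Rightarrow> ('e \<times> 'e) set \<Rightarrow> real \<Rightarrow> complex \<Rightarrow> complex" where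
  "zeta_trace src rng tauhat H \<rho> z =
     (let E = E_all src rng tauhat H
      in op_trace E (op_abs_cpower E (dirac src rng tauhat H \<rho>) (- z)))"

definition metric_dimension ::
    "('e \<Rightarrow> 'v) \<Rightarrow> ('e \<Rightarrow> 'v) \<Rightarrow> ('e \<Rightarrow> 'e) \<Rightarrow> ('e \<times> 'e) set \<Rightarrow> real \<Rightarrow> ereal" where
  "metric_dimension src rng tauhat H \<rho> = Inf {ereal (Re z) |z. zeta_converges src rng tauhat H \<rho> z}"

text \<open>
  If \<open>\<mu> = 0\<close> is an eigenvalue, \<open>C\<close> is 0 here because of \<open>1 / 0 = 0\<close>. That eigenvalue only
  contributes a constant multiple of \<open>\<rho>\<^sup>z\<close> (from \<open>n = 1\<close>) to the zeta function, which is entire.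

  Residues: at a simple zero of \<open>1 - \<mu> \<rho>\<^sup>z\<close> the derivative of this function is
  \<open>- \<mu> \<rho>\<^sup>z ln \<rho> = - ln \<rho>\<close>, so \<open>C / (1 - \<mu> \<rho>\<^sup>z)\<close> has residue \<open>C / (- ln \<rho>)\<close> there; a
  further factor \<open>\<mu>\<close>, sometimes printed in the residue formula, is incompatible with this
  expansion.
\<close>

definition C_const ::
    "('e \<Rightarrow> 'v::finite) \<Rightarrow> ('e \<times> 'e) set \<Rightarrow> complex \<Rightarrow> nat \<Rightarrow> (nat \<Rightarrow> complex ^ 'v) \<Rightarrow> (nat \<Rightarrow> complex ^ 'v) \<Rightarrow> complex" where
  "C_const src H \<mu> m R L =
     1 / \<mu> * (\<Sum>l=1..m. \<Sum>v\<in>UNIV. \<Sum>h\<in>H. R l $ v * L l $ src (fst h))"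

end

theory Submission
  imports Defs
begin

text \<open>
  An edge of level \<open>n\<close> consists of a path of length \<open>n - 1\<close> and a pair in \<open>H\<close>, and on the two-dimensional
  space spanned by \<open>e\<close> and its reversal the operator \<open>D\<close> has the eigenvalues \<open>\<plusminus>\<rho>\<^sup>-\<^sup>n\<close>. So the trace is the
  power series \<open>\<Sum>\<^sub>n N\<^sub>n q\<^sup>n\<close> at \<open>q = \<rho>\<^sup>z\<close>, where \<open>N\<^sub>n\<close> counts the edges of level \<open>n\<close>. The
  biorthogonal eigenbases turn \<open>N\<^sub>n\<close> into a combination of the powers \<open>\<lambda>\<^sub>j\<^sup>n\<^sup>-\<^sup>1\<close>, and summing the geometric
  series \<open>K q / (1 - \<lambda> q)\<close> gives \<open>C / (1 - \<lambda> q) - C\<close> with \<open>C = K / \<lambda>\<close> if \<open>\<lambda> \<noteq> 0\<close>, and the entire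
  function \<open>K q\<close> if \<open>\<lambda> = 0\<close>. The abscissa of convergence follows from \<open>N\<^sub>n \<ge> c \<lambda>\<^sub>P\<^sub>F\<^sup>n\<close>, a consequence
  of the existence of a positive eigenvector.
\<close>

section \<open>Perron-Frobenius theory for diagonalizable matrices\<close>

lemma matrix_inv_left_right:
  assumes "invertible P"
  shows "P ** matrix_inv P = mat 1" "matrix_inv P ** P = mat 1"
  using someI_ex [OF assms [unfolded invertible_def]] unfolding matrix_inv_def by auto

text \<open>From \<open>A ** P = P ** \<Lambda>\<close> each column of \<open>P\<close> lies in the
  eigenspace of the matching diagonal entry, and the columns span because \<open>P\<close> is
  invertible.\<close>

lemma diagonalizable_span_eigenvectors:
  fixes A :: "complex ^ 'n ^ 'n"
  assumes "diagonalizable_matrix A"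
  shows "vec.span (\<Union>\<mu>\<in>eigenvalues A. right_eigenspace A \<mu>) = UNIV"
proof -
  obtain P \<Lambda> :: "complex ^ 'n ^ 'n" where P: "invertible P"
    and diag: "\<And>i j. i \<noteq> j \<Longrightarrow> \<Lambda> $ i $ j = 0" and A: "A = P ** \<Lambda> ** matrix_inv P"
    using assms unfolding diagonalizable_matrix_def by blast
  have AP: "A ** P = P ** \<Lambda>"
    using P by (simp add: A matrix_mul_assoc [symmetric] matrix_inv_left_right)
  have eig: "A *v column i P = (\<Lambda> $ i $ i) *s column i P" for i
  proof (rule vec_eq_iff [THEN iffD2], rule allI)
    fix v
    have "(A *v column i P) $ v = (A ** P) $ v $ i"
      by (simp add: matrix_vector_mult_def matrix_matrix_mult_def column_def)
    also have "\<dots> = (\<Sum>k\<in>UNIV. P $ v $ k * \<Lambda> $ k $ i)"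
      by (subst AP) (simp add: matrix_matrix_mult_def)
    also have "\<dots> = (\<Sum>k\<in>{i}. P $ v $ k * \<Lambda> $ k $ i)"
      by (rule sum.mono_neutral_right) (auto simp: diag)
    finally show "(A *v column i P) $ v = ((\<Lambda> $ i $ i) *s column i P) $ v"
      by (simp add: column_def mult.commute)
  qed
  have col: "column i P \<in> vec.span (\<Union>\<mu>\<in>eigenvalues A. right_eigenspace A \<mu>)" for i
  proof (cases "column i P = 0")
    case False
    have "column i P \<in> right_eigenspace A (\<Lambda> $ i $ i)"
      by (simp add: right_eigenspace_def eig)
    moreover from this have "\<Lambda> $ i $ i \<in> eigenvalues A"
      using False by (auto simp: eigenvalues_def)
    ultimately show ?thesis by (intro vec.span_base) blast
  qed (simp add: vec.span_zero)
  have "x \<in> vec.span (\<Union>\<mu>\<in>eigenvalues A. right_eigenspace A \<mu>)" for x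
  proof -
    have "x = P *v (matrix_inv P *v x)"
      using P by (simp add: matrix_vector_mul_assoc matrix_inv_left_right)
    also have "\<dots> = (\<Sum>i\<in>UNIV. (matrix_inv P *v x) $ i *s column i P)"
      by (rule matrix_mult_sum)
    also have "\<dots> \<in> vec.span (\<Union>\<mu>\<in>eigenvalues A. right_eigenspace A \<mu>)"
      by (intro vec.span_sum vec.span_scale col)
    finally show ?thesis .
  qed
  thus ?thesis by blast
qed

lemma diagonalizable_eigenvalues_nonempty:
  fixes A :: "complex ^ 'n ^ 'n"
  assumes "diagonalizable_matrix A"
  shows "eigenvalues A \<noteq> {}"
proof
  assume "eigenvalues A = {}"
  hence "(UNIV :: (complex ^ 'n) set) = {0}"
    using diagonalizable_span_eigenvectors [OF assms] by simp
  hence "(vec 1 :: complex ^ 'n) = 0" by blast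
  thus False by (simp add: vec_eq_iff)
qed

section \<open>Iterates of a matrix and their growth\<close>

lemma funpow_mult_vec_add:
  fixes A :: "'a::field ^ 'n ^ 'n"
  shows "((*v) A ^^ n) (x + y) = ((*v) A ^^ n) x + ((*v) A ^^ n) y"
  by (induction n) (auto simp: matrix_vector_right_distrib)

lemma funpow_mult_vec_scale:
  fixes A :: "'a::field ^ 'n ^ 'n"
  shows "((*v) A ^^ n) (c *s x) = c *s ((*v) A ^^ n) x"
  by (induction n) (auto simp: vector_scalar_commute)

lemma eigenvector_funpow:
  fixes A :: "'a::field ^ 'n ^ 'n"
  assumes "A *v x = \<mu> *s x"
  shows "((*v) A ^^ n) x = \<mu> ^ n *s x"
  by (induction n) (use assms in \<open>auto simp: vector_scalar_commute algebra_simps\<close>)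

lemma matrix_funpow_mult_vec:
  fixes A :: "'a::field ^ 'n ^ 'n"
  shows "((**) A ^^ n) (mat 1) *v x = ((*v) A ^^ n) x"
  by (induction n) (auto simp: matrix_vector_mul_assoc [symmetric])

text \<open>Each eigenvector in an expansion of \<open>x\<close> is only rescaled by
  \<open>\<mu> ^ n\<close>, without the polynomial factor that a Jordan block would bring. The
  constant may depend on \<open>x\<close>, so the induction over the span can add up bounds.\<close>

lemma diagonalizable_power_bound:
  fixes A :: "complex ^ 'n ^ 'n"
  assumes diag: "diagonalizable_matrix A" and r: "\<And>\<mu>. \<mu> \<in> eigenvalues A \<Longrightarrow> cmod \<mu> \<le> r"
  shows "\<exists>K. \<forall>n v. cmod (((*v) A ^^ n) x $ v) \<le> K * r ^ n"
proof -
  have "r \<ge> 0"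
    using diagonalizable_eigenvalues_nonempty [OF diag] r norm_ge_zero order_trans by blast
  have "x \<in> vec.span (\<Union>\<mu>\<in>eigenvalues A. right_eigenspace A \<mu>)"
    using diagonalizable_span_eigenvectors [OF diag] by simp
  thus ?thesis
  proof (induction rule: vec.span_induct_alt)
    case base
    have "((*v) A ^^ n) 0 = 0" for n by (induction n) auto
    thus ?case by (intro exI [of _ 0]) auto
  next
    case (step c x y)
    then obtain K \<mu> where \<mu>: "\<mu> \<in> eigenvalues A" "x \<in> right_eigenspace A \<mu>"
      and K: "\<And>n v. cmod (((*v) A ^^ n) y $ v) \<le> K * r ^ n" by blast
    have "cmod (((*v) A ^^ n) (c *s x + y) $ v) \<le> (cmod c * (\<Sum>v\<in>UNIV. cmod (x $ v)) + K) * r ^ n"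
      for n v
    proof -
      have "((*v) A ^^ n) x = \<mu> ^ n *s x"
        using \<mu>(2) by (intro eigenvector_funpow) (simp add: right_eigenspace_def)
      hence "((*v) A ^^ n) (c *s x + y) $ v = c * x $ v * \<mu> ^ n + ((*v) A ^^ n) y $ v"
        by (simp add: funpow_mult_vec_add funpow_mult_vec_scale)
      also have "cmod \<dots> \<le> cmod c * cmod (x $ v) * cmod \<mu> ^ n + K * r ^ n"
        by (intro norm_triangle_mono K) (simp add: norm_mult norm_power)
      also have "cmod c * cmod (x $ v) * cmod \<mu> ^ n \<le> cmod c * (\<Sum>v\<in>UNIV. cmod (x $ v)) * r ^ n"
        by (intro mult_mono power_mono r \<mu>)
           (auto intro!: member_le_sum mult_nonneg_nonneg sum_nonneg)
      finally show ?thesis by (simp add: algebra_simps)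
    qed
    thus ?case by blast
  qed
qed

text \<open>
  If \<open>B y \<ge> r y\<close> were strict in one entry, applying a positive power of \<open>B\<close> would give a vector \<open>u\<close>
  with \<open>B u \<ge> s u\<close> for some \<open>s > r\<close>, and \<open>B\<^sup>n u\<close> would outgrow \<open>r\<^sup>n\<close>.
\<close>

lemma primitive_subinvariant_vector:
  fixes B :: "real ^ 'n ^ 'n" and y :: "real ^ 'n"
  assumes nonneg: "\<And>i j. B $ i $ j \<ge> 0" and prim: "primitive_matrix B"
    and growth: "\<And>u. \<exists>K. \<forall>n v. \<bar>((*v) B ^^ n) u $ v\<bar> \<le> K * r ^ n"
    and "r \<ge> 0" and y: "\<And>v. y $ v \<ge> 0" "y \<noteq> 0" and sub: "\<And>v. r * y $ v \<le> (B *v y) $ v"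
  shows "B *v y = r *s y" "\<And>v. y $ v > 0" "r > 0"
proof -
  obtain k where "k \<ge> 1" and k: "\<And>i j. ((**) B ^^ k) (mat 1) $ i $ j > 0"
    using prim unfolding primitive_matrix_def by blast
  have pos: "((*v) B ^^ k) x $ v > 0" if x: "\<And>w. x $ w \<ge> 0" "x \<noteq> 0" for x :: "real ^ 'n" and v
  proof -
    obtain w where "x $ w \<noteq> 0" using x(2) by (auto simp: vec_eq_iff)
    hence "x $ w > 0" using x(1) [of w] by simp
    hence "(\<Sum>w\<in>UNIV. ((**) B ^^ k) (mat 1) $ v $ w * x $ w) > 0"
      using k x(1) by (intro sum_pos2 [of UNIV w] mult_nonneg_nonneg) (auto intro: less_imp_le)
    thus ?thesis by (simp flip: matrix_funpow_mult_vec add: matrix_vector_mult_def)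
  qed
  define z where "z = B *v y - r *s y"
  define u where "u = ((*v) B ^^ k) y"
  have u_pos: "u $ v > 0" for v unfolding u_def using y by (intro pos)
  \<comment> \<open>Since powers of \<open>B\<close> commute with \<open>B\<close>, the slack
    \<open>z\<close> of the inequality reappears for \<open>u\<close> multiplied by a positive
    matrix: positive in every entry unless \<open>z = 0\<close>.\<close>
  have Bu: "B *v u = r *s u + ((*v) B ^^ k) z"
  proof -
    have "B *v u = ((*v) B ^^ k) (B *v y)"
      by (simp add: u_def funpow_swap1)
    also have "B *v y = r *s y + z" by (simp add: z_def)
    finally show ?thesis by (simp add: funpow_mult_vec_add funpow_mult_vec_scale u_def)
  qed
  have "z = 0"
  proof (rule ccontr)
    assume "z \<noteq> 0"
    hence zk: "((*v) B ^^ k) z $ v > 0" for v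
      using sub by (intro pos) (auto simp: z_def)
    \<comment> \<open>The Collatz-Wielandt quotient of \<open>u\<close>: the largest
      \<open>s\<close> with \<open>s * u \<le> B *v u\<close> entrywise. As a minimum over finitely
      many entries it stays strictly above \<open>r\<close>.\<close>
    define s where "s = Min (range (\<lambda>v. (B *v u) $ v / u $ v))"
    have s_le: "s * u $ v \<le> (B *v u) $ v" for v
    proof -
      have "s \<le> (B *v u) $ v / u $ v" unfolding s_def by (intro Min_le) auto
      thus ?thesis using u_pos [of v] by (simp add: field_simps)
    qed
    have "s > r" unfolding s_def
    proof (subst Min_gr_iff, simp_all, rule allI)
      fix v
      show "r < (B *v u) $ v / u $ v"
        using u_pos [of v] zk [of v] by (simp add: Bu field_simps)
    qed
    have iter: "s ^ n * u $ v \<le> ((*v) B ^^ n) u $ v" for n v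
    proof (induction n arbitrary: v)
      case (Suc n)
      have "s ^ Suc n * u $ v \<le> s ^ n * (B *v u) $ v"
        using mult_left_mono [OF s_le [of v], of "s ^ n"] \<open>s > r\<close> \<open>r \<ge> 0\<close> by (simp add: algebra_simps)
      also have "\<dots> = (\<Sum>w\<in>UNIV. B $ v $ w * (s ^ n * u $ w))"
        by (simp add: matrix_vector_mult_def sum_distrib_left algebra_simps)
      also have "\<dots> \<le> (\<Sum>w\<in>UNIV. B $ v $ w * ((*v) B ^^ n) u $ w)"
        by (intro sum_mono mult_left_mono Suc nonneg)
      also have "\<dots> = (B *v ((*v) B ^^ n) u) $ v" by (simp add: matrix_vector_mult_def)
      finally show ?case by simp
    qed simp
    fix v :: 'n
    obtain K where "\<And>n v. \<bar>((*v) B ^^ n) u $ v\<bar> \<le> K * r ^ n" using growth by blast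
    hence K: "s ^ n * u $ v \<le> K * r ^ n" for n
      using iter [of n v] by (meson abs_ge_self order_trans)
    have "K > 0" using K [of 0] u_pos [of v] by simp
    obtain n where "(r / s) ^ n < u $ v / K"
      using real_arch_pow_inv [of "u $ v / K" "r / s"] u_pos [of v] \<open>K > 0\<close> \<open>s > r\<close> \<open>r \<ge> 0\<close> by auto
    moreover have "s ^ n > 0" using \<open>s > r\<close> \<open>r \<ge> 0\<close> by simp
    ultimately have "K * r ^ n < s ^ n * u $ v"
      using \<open>K > 0\<close> by (simp add: field_simps power_divide)
    with K [of n] show False by simp
  qed
  thus *: "B *v y = r *s y" by (simp add: z_def)
  \<comment> \<open>With equality established, \<open>u\<close> is a multiple of \<open>y\<close>,
    so its positivity passes to \<open>y\<close> and to \<open>r ^ k\<close>.\<close>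
  have u: "u = r ^ k *s y" unfolding u_def by (rule eigenvector_funpow) fact
  show "y $ v > 0" for v
    using u_pos [of v] y(1) [of v] by (auto simp: u zero_less_mult_iff)
  have "r ^ k * y $ undefined > 0" using u_pos [of undefined] by (simp add: u)
  hence "r ^ k \<noteq> 0" by fastforce
  thus "r > 0" using \<open>k \<ge> 1\<close> \<open>r \<ge> 0\<close> by simp
qed


text \<open>The equality case of the triangle inequality: after rotating by the phase
  \<open>c\<close> of the sum, the real part of every term must reach its modulus, because the
  nonnegative defects add up to 0.\<close>

lemma norm_sum_eq_sum_imp_aligned:
  fixes x :: "'i \<Rightarrow> complex"
  assumes "finite I" and b: "\<And>i. i \<in> I \<Longrightarrow> b i > 0"
    and eq: "cmod (\<Sum>i\<in>I. of_real (b i) * x i) = (\<Sum>i\<in>I. b i * cmod (x i))"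
  obtains c where "c \<noteq> 0" "\<And>i. i \<in> I \<Longrightarrow> x i = c * of_real (cmod (x i))"
proof -
  define S where "S = (\<Sum>i\<in>I. of_real (b i) * x i)"
  \<comment> \<open>A vanishing sum has no phase; the default 1 still has modulus 1 and makes
    \<open>cnj c * S\<close> equal to the modulus of \<open>S\<close>.\<close>
  define c where "c = (if S = 0 then 1 else sgn S)"
  have "cmod c = 1" by (simp add: c_def norm_sgn)
  have "cnj c * S = of_real (cmod S)"
    by (auto simp: c_def sgn_eq complex_norm_square [symmetric] power2_eq_square field_simps)
  moreover have "cnj c * S = (\<Sum>i\<in>I. of_real (b i) * (cnj c * x i))"
    by (simp add: S_def sum_distrib_left mult.left_commute)
  moreover have "Re (of_real (b i) * (cnj c * x i)) = b i * Re (cnj c * x i)" for i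
    by simp
  ultimately have "(\<Sum>i\<in>I. b i * Re (cnj c * x i)) = cmod S"
    by (metis (no_types, lifting) Re_complex_of_real Re_sum sum.cong)
  hence "(\<Sum>i\<in>I. b i * (cmod (x i) - Re (cnj c * x i))) = 0"
    using eq by (simp add: S_def right_diff_distrib sum_subtractf)
  moreover have le: "Re (cnj c * x i) \<le> cmod (x i)" for i
    using complex_Re_le_cmod [of "cnj c * x i"] \<open>cmod c = 1\<close> by (simp add: norm_mult)
  moreover have "0 \<le> b i * (cmod (x i) - Re (cnj c * x i))" if "i \<in> I" for i
    using b [OF that] le [of i] by (intro mult_nonneg_nonneg) auto
  ultimately have "b i * (cmod (x i) - Re (cnj c * x i)) = 0" if "i \<in> I" for i
    using that sum_nonneg_eq_0_iff [OF \<open>finite I\<close>, of "\<lambda>i. b i * (cmod (x i) - Re (cnj c * x i))"]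
    by blast
  hence "Re (cnj c * x i) = cmod (cnj c * x i)" if "i \<in> I" for i
    using that b [OF that] \<open>cmod c = 1\<close> by (fastforce simp: norm_mult)
  hence "cnj c * x i = of_real (cmod (x i))" if "i \<in> I" for i
    using that cmod_power2 [of "cnj c * x i"] \<open>cmod c = 1\<close>
    by (simp add: complex_eq_iff norm_mult)
  moreover have "c * cnj c = 1" using \<open>cmod c = 1\<close> by (simp add: complex_norm_square [symmetric])
  ultimately have "x i = c * of_real (cmod (x i))" if "i \<in> I" for i
    using that by (metis mult.assoc mult_1)
  moreover have "c \<noteq> 0" using \<open>cmod c = 1\<close> by auto
  ultimately show ?thesis by (rule that [rotated])
qed

text \<open>For an eigenvalue of maximal modulus \<open>r\<close>, the entrywise moduli of an
  eigenvector form a subinvariant vector, hence a positive eigenvector for \<open>r\<close>. A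
  competing eigenvalue of modulus \<open>r\<close> would have an eigenvector with aligned entries,
  that is, a multiple of such a positive vector, and would therefore equal \<open>r\<close>.\<close>

theorem diagonalizable_perron_frobenius:
  fixes B :: "real ^ 'n ^ 'n" and A :: "complex ^ 'n ^ 'n"
  defines "A \<equiv> \<chi> i j. complex_of_real (B $ i $ j)"
  assumes nonneg: "\<And>i j. B $ i $ j \<ge> 0" and prim: "primitive_matrix B"
    and diag: "diagonalizable_matrix A" and fin: "finite (eigenvalues A)"
  obtains r :: real and y :: "real ^ 'n" where "r > 0" "complex_of_real r \<in> eigenvalues A"
    "\<And>\<mu>. \<lbrakk>\<mu> \<in> eigenvalues A; \<mu> \<noteq> complex_of_real r\<rbrakk> \<Longrightarrow> cmod \<mu> < r"
    "\<And>v. y $ v > 0" "B *v y = r *s y"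
proof -
  define r where "r = Max (cmod ` eigenvalues A)"
  have ne: "eigenvalues A \<noteq> {}" by (rule diagonalizable_eigenvalues_nonempty [OF diag])
  have r_ge: "cmod \<mu> \<le> r" if "\<mu> \<in> eigenvalues A" for \<mu>
    unfolding r_def using fin that by simp
  have "r \<in> cmod ` eigenvalues A" unfolding r_def using fin ne by (intro Max_in) auto
  then obtain \<mu>0 where \<mu>0: "\<mu>0 \<in> eigenvalues A" "cmod \<mu>0 = r" by blast
  hence "r \<ge> 0" by auto
  define cx :: "real ^ 'n \<Rightarrow> complex ^ 'n" where "cx u = (\<chi> v. complex_of_real (u $ v))" for u
  have cx_mult: "A *v cx u = cx (B *v u)" for u
    by (simp add: vec_eq_iff cx_def A_def matrix_vector_mult_def)
  have cx_funpow: "((*v) A ^^ n) (cx u) = cx (((*v) B ^^ n) u)" for n u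
    by (induction n) (simp_all add: cx_mult)
  have growth: "\<exists>K. \<forall>n v. \<bar>((*v) B ^^ n) u $ v\<bar> \<le> K * r ^ n" for u
    using diagonalizable_power_bound [OF diag r_ge, of "cx u"] unfolding cx_funpow
    by (simp add: cx_def)
  have abs_eigenvector: "B *v y = r *s y" "\<And>v. y $ v > 0" "r > 0"
    if \<mu>: "cmod \<mu> = r" "A *v x = \<mu> *s x" "x \<noteq> 0" and y: "y = (\<chi> v. cmod (x $ v))"
    for \<mu> and x :: "complex ^ 'n" and y :: "real ^ 'n"
  proof -
    have nn: "y $ v \<ge> 0" for v by (simp add: y)
    have nz: "y \<noteq> 0" using \<mu>(3) by (auto simp: y vec_eq_iff)
    have sub: "r * y $ v \<le> (B *v y) $ v" for v
    proof -
      have "r * y $ v = cmod ((A *v x) $ v)" using \<mu> by (simp add: y norm_mult)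
      also have "\<dots> \<le> (\<Sum>w\<in>UNIV. cmod (A $ v $ w * x $ w))"
        unfolding matrix_vector_mult_def by (simp add: norm_sum)
      also have "\<dots> = (B *v y) $ v"
        by (simp add: matrix_vector_mult_def norm_mult A_def y nonneg)
      finally show ?thesis .
    qed
    note * = primitive_subinvariant_vector [OF nonneg prim growth \<open>r \<ge> 0\<close> nn nz sub]
    show "B *v y = r *s y" "\<And>v. y $ v > 0" "r > 0" by (fact *)+
  qed
  obtain x0 where x0: "A *v x0 = \<mu>0 *s x0" "x0 \<noteq> 0"
    using \<mu>0(1) by (auto simp: eigenvalues_def right_eigenspace_def)
  define y :: "real ^ 'n" where "y = (\<chi> v. cmod (x0 $ v))"
  note y = abs_eigenvector [OF \<mu>0(2) x0 y_def]
  have r_eig: "complex_of_real r \<in> eigenvalues A"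
  proof -
    have "A *v cx y = complex_of_real r *s cx y"
      unfolding cx_mult y(1) by (simp add: cx_def vec_eq_iff)
    moreover have "cx y \<noteq> 0"
      using y(2) less_imp_neq by (fastforce simp: cx_def vec_eq_iff)
    ultimately show ?thesis by (auto simp: eigenvalues_def right_eigenspace_def)
  qed
  have dom: "cmod \<mu> < r" if \<mu>: "\<mu> \<in> eigenvalues A" "\<mu> \<noteq> complex_of_real r" for \<mu>
  proof (rule ccontr)
    assume "\<not> cmod \<mu> < r"
    hence r: "cmod \<mu> = r" using r_ge [OF \<mu>(1)] by simp
    obtain x where x: "A *v x = \<mu> *s x" "x \<noteq> 0"
      using \<mu>(1) by (auto simp: eigenvalues_def right_eigenspace_def)
    define z :: "real ^ 'n" where "z = (\<chi> v. cmod (x $ v))"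
    note z = abs_eigenvector [OF r x z_def]
    obtain k where k: "\<And>i j. (((**) B ^^ k) (mat 1)) $ i $ j > 0"
      using prim unfolding primitive_matrix_def by blast
    \<comment> \<open>One row of the positive power suffices: all its weights are positive, so it
      aligns all entries of \<open>x\<close>.\<close>
    fix v :: 'n
    have Bk: "((*v) B ^^ k) u $ v = (\<Sum>w\<in>UNIV. (((**) B ^^ k) (mat 1)) $ v $ w * u $ w)" for u
      by (simp flip: matrix_funpow_mult_vec add: matrix_vector_mult_def)
    have Ak: "((*v) A ^^ k) x $ v = (\<Sum>w\<in>UNIV. of_real ((((**) B ^^ k) (mat 1)) $ v $ w) * x $ w)"
    proof -
      have "((**) A ^^ k) (mat 1) = (\<chi> i j. complex_of_real ((((**) B ^^ k) (mat 1)) $ i $ j))"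
        by (induction k) (auto simp: vec_eq_iff mat_def matrix_matrix_mult_def A_def)
      thus ?thesis by (simp flip: matrix_funpow_mult_vec add: matrix_vector_mult_def)
    qed
    \<comment> \<open>The triangle inequality in row \<open>v\<close> is an equality, since
      \<open>x\<close> and its vector of moduli \<open>z\<close> are eigenvectors whose eigenvalues
      have the same modulus \<open>r\<close>.\<close>
    have "cmod (((*v) A ^^ k) x $ v) = r ^ k * cmod (x $ v)"
      using r by (simp add: eigenvector_funpow [OF x(1)] norm_mult norm_power)
    also have "\<dots> = ((*v) B ^^ k) z $ v"
      by (simp add: eigenvector_funpow [OF z(1)]) (simp add: z_def)
    finally obtain c where c: "c \<noteq> 0" "\<And>w. x $ w = c * of_real (cmod (x $ w))"
      unfolding Ak Bk z_def
      using norm_sum_eq_sum_imp_aligned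
        [of UNIV "\<lambda>w. (((**) B ^^ k) (mat 1)) $ v $ w" "\<lambda>w. x $ w"] k by auto
    have x_eq: "x = c *s cx z" using c(2) by (simp add: vec_eq_iff cx_def z_def)
    have "A *v x = c *s cx (r *s z)"
      by (subst x_eq) (simp only: vector_scalar_commute cx_mult z(1))
    also have "\<dots> = complex_of_real r *s x"
      by (subst x_eq) (simp add: vec_eq_iff cx_def)
    finally have "(\<mu> *s x) $ v = (complex_of_real r *s x) $ v" by (simp only: x(1))
    hence "\<mu> * x $ v = complex_of_real r * x $ v" by simp
    moreover have "x $ v \<noteq> 0" using z(2) [of v] by (auto simp: z_def)
    ultimately show False using \<mu>(2) by auto
  qed
  show ?thesis by (rule that [OF y(3) r_eig dom y(2) y(1)])
qed

section \<open>Counting paths\<close>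

text \<open>The end condition is void for the empty list, which thus stands for the vertex
  \<open>w\<close> itself: exactly one path of length 0 ends at each vertex.\<close>

definition paths_to :: "('e \<Rightarrow> 'v) \<Rightarrow> ('e \<Rightarrow> 'v) \<Rightarrow> nat \<Rightarrow> 'v \<Rightarrow> 'e list set" where
  "paths_to src rng m w =
     {\<eta>. length \<eta> = m \<and> is_path src rng \<eta> \<and> (\<eta> \<noteq> [] \<longrightarrow> rng (last \<eta>) = w)}"

lemma paths_to_0 [simp]: "paths_to src rng 0 w = {[]}"
  by (auto simp: paths_to_def is_path_def)

lemma is_path_singleton [simp]: "is_path src rng [\<epsilon>]"
  by (simp add: is_path_def)

lemma is_path_snoc:
  "is_path src rng (\<eta> @ [\<epsilon>]) \<longleftrightarrow> is_path src rng \<eta> \<and> (\<eta> \<noteq> [] \<longrightarrow> rng (last \<eta>) = src \<epsilon>)"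
  by (auto simp: is_path_def successively_append_iff)

lemma paths_to_Suc:
  "paths_to src rng (Suc m) w =
     (\<Union>\<epsilon>\<in>{\<epsilon>. rng \<epsilon> = w}. (\<lambda>\<eta>. \<eta> @ [\<epsilon>]) ` paths_to src rng m (src \<epsilon>))" (is "?L = ?R")
proof
  show "?L \<subseteq> ?R"
  proof
    fix p assume p: "p \<in> ?L"
    then obtain \<eta> \<epsilon> where "p = \<eta> @ [\<epsilon>]"
      by (cases p rule: rev_cases) (auto simp: paths_to_def)
    with p show "p \<in> ?R" by (auto simp: paths_to_def is_path_snoc)
  qed
qed (auto simp: paths_to_def is_path_snoc)

lemma finite_paths_to:
  fixes src rng :: "'e::finite \<Rightarrow> 'v"
  shows "finite (paths_to src rng m w)"
  by (rule finite_subset [OF _ finite_lists_length_eq [of UNIV m]]) (auto simp: paths_to_def)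

lemma card_paths_to_Suc:
  fixes src rng :: "'e::finite \<Rightarrow> 'v"
  shows "card (paths_to src rng (Suc m) w) =
    (\<Sum>\<epsilon> | rng \<epsilon> = w. card (paths_to src rng m (src \<epsilon>)))"
proof -
  have "card (paths_to src rng (Suc m) w) =
      (\<Sum>\<epsilon> | rng \<epsilon> = w. card ((\<lambda>\<eta>. \<eta> @ [\<epsilon>]) ` paths_to src rng m (src \<epsilon>)))"
    unfolding paths_to_Suc by (intro card_UN_disjoint) (auto simp: finite_paths_to)
  also have "\<dots> = (\<Sum>\<epsilon> | rng \<epsilon> = w. card (paths_to src rng m (src \<epsilon>)))"
    by (intro sum.cong card_image) (auto intro: inj_onI)
  finally show ?thesis .
qed

lemma sum_edges_into:
  fixes src rng :: "'e::finite \<Rightarrow> 'v::finite" and f :: "'v \<Rightarrow> 'a::comm_semiring_1"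
  shows "(\<Sum>\<epsilon> | rng \<epsilon> = w. f (src \<epsilon>)) = (\<Sum>u\<in>UNIV. f u * graph_matrix src rng $ u $ w)"
proof -
  have "(\<Sum>\<epsilon> | rng \<epsilon> = w. f (src \<epsilon>)) = (\<Sum>u\<in>UNIV. \<Sum>\<epsilon> | \<epsilon> \<in> {\<epsilon>. rng \<epsilon> = w} \<and> src \<epsilon> = u. f (src \<epsilon>))"
    by (rule sum.group [symmetric]) auto
  also have "\<dots> = (\<Sum>u\<in>UNIV. \<Sum>\<epsilon> | src \<epsilon> = u \<and> rng \<epsilon> = w. f u)"
    by (intro sum.cong) auto
  also have "\<dots> = (\<Sum>u\<in>UNIV. f u * graph_matrix src rng $ u $ w)"
    by (simp add: graph_matrix_def mult.commute)
  finally show ?thesis .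
qed

lemma of_nat_card_paths_to_Suc:
  fixes src rng :: "'e::finite \<Rightarrow> 'v::finite"
  shows "(of_nat (card (paths_to src rng (Suc m) w)) :: 'a::comm_semiring_1) =
     (\<Sum>u\<in>UNIV. of_nat (card (paths_to src rng m u)) * graph_matrix src rng $ u $ w)"
  using sum_edges_into [where f = "\<lambda>v. of_nat (card (paths_to src rng m v))" and src = src and rng = rng and w = w]
  by (simp add: card_paths_to_Suc)

text \<open>The counts form the row vector of ones times the \<open>m\<close>-th power of the
  matrix, so each further edge multiplies the pairing with \<open>x\<close> by
  \<open>\<mu>\<close>.\<close>

lemma card_paths_to_right_eigenvector:
  fixes src rng :: "'e::finite \<Rightarrow> 'v::finite" and x :: "'a::field ^ 'v"
  assumes "graph_matrix src rng *v x = \<mu> *s x"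
  shows "(\<Sum>v\<in>UNIV. of_nat (card (paths_to src rng m v)) * x $ v) = \<mu> ^ m * (\<Sum>v\<in>UNIV. x $ v)"
proof (induction m)
  case (Suc m)
  have "(\<Sum>v\<in>UNIV. of_nat (card (paths_to src rng (Suc m) v)) * x $ v) =
      (\<Sum>v\<in>UNIV. \<Sum>u\<in>UNIV. of_nat (card (paths_to src rng m u)) * graph_matrix src rng $ u $ v * x $ v)"
    by (simp add: of_nat_card_paths_to_Suc sum_distrib_right)
  also have "\<dots> = (\<Sum>u\<in>UNIV. of_nat (card (paths_to src rng m u)) * (graph_matrix src rng *v x) $ u)"
    by (subst sum.swap) (simp add: matrix_vector_mult_def sum_distrib_left mult.assoc)
  also have "\<dots> = \<mu> * (\<Sum>u\<in>UNIV. of_nat (card (paths_to src rng m u)) * x $ u)"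
    by (simp add: assms sum_distrib_left algebra_simps)
  finally show ?case by (simp add: Suc)
qed simp

lemma card_paths_to_add:
  fixes src rng :: "'e::finite \<Rightarrow> 'v::finite"
  defines "B \<equiv> graph_matrix src rng :: 'a::comm_semiring_1 ^ 'v ^ 'v"
  shows "of_nat (card (paths_to src rng (m + k) w)) =
    (\<Sum>u\<in>UNIV. of_nat (card (paths_to src rng m u)) * (((**) B ^^ k) (mat 1)) $ u $ w)"
\<comment> \<open>The iterated product gains its new factor on the left, next to the counts, so the
  step needs the hypothesis at \<open>Suc m\<close>.\<close>
proof (induction k arbitrary: m)
  case 0
  have "(\<Sum>u\<in>UNIV. of_nat (card (paths_to src rng m u)) * (mat 1 :: 'a ^ 'v ^ 'v) $ u $ w) =
      (\<Sum>u\<in>{w}. of_nat (card (paths_to src rng m u)) * (mat 1 :: 'a ^ 'v ^ 'v) $ u $ w)"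
    by (rule sum.mono_neutral_right) (auto simp: mat_def)
  thus ?case by (simp add: mat_def)
next
  case (Suc k)
  have "of_nat (card (paths_to src rng (m + Suc k) w)) =
      (\<Sum>u\<in>UNIV. of_nat (card (paths_to src rng (Suc m) u)) * (((**) B ^^ k) (mat 1)) $ u $ w)"
    using Suc.IH [of "Suc m"] by simp
  also have "\<dots> = (\<Sum>u\<in>UNIV. \<Sum>t\<in>UNIV. of_nat (card (paths_to src rng m t)) * B $ t $ u *
      (((**) B ^^ k) (mat 1)) $ u $ w)"
    by (simp add: of_nat_card_paths_to_Suc B_def sum_distrib_right)
  also have "\<dots> = (\<Sum>t\<in>UNIV. of_nat (card (paths_to src rng m t)) * (((**) B ^^ Suc k) (mat 1)) $ t $ w)"
    by (subst sum.swap) (simp add: matrix_matrix_mult_def [of B "((**) B ^^ k) (mat 1)"] sum_distrib_left mult.assoc)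
  finally show ?case .
qed

text \<open>Every column of a positive power of \<open>B\<close> dominates
  \<open>\<delta> * y\<close>, and the pairing of the counts with \<open>y\<close> grows exactly
  like \<open>r ^ m\<close>. So \<open>k\<close> extra steps spread this growth to every end
  vertex.\<close>

lemma card_paths_to_lower_bound:
  fixes src rng :: "'e::finite \<Rightarrow> 'v::finite" and y :: "real ^ 'v"
  defines "B \<equiv> graph_matrix src rng :: real ^ 'v ^ 'v"
  assumes prim: "primitive_matrix B" and y: "\<And>v. y $ v > 0" "B *v y = r *s y" and "r > 0"
  obtains c k where "c > 0" "\<And>m w. c * r ^ m \<le> real (card (paths_to src rng (m + k) w))"
proof -
  obtain k where k: "\<And>i j. (((**) B ^^ k) (mat 1)) $ i $ j > 0"
    using prim unfolding primitive_matrix_def by blast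
  define \<delta> where "\<delta> = Min (range (\<lambda>(i, j). (((**) B ^^ k) (mat 1)) $ i $ j / y $ i))"
  have "\<delta> > 0" unfolding \<delta>_def by (subst Min_gr_iff) (auto simp: k y(1))
  have \<delta>: "\<delta> * y $ i \<le> (((**) B ^^ k) (mat 1)) $ i $ j" for i j
  proof -
    have "\<delta> \<le> (((**) B ^^ k) (mat 1)) $ i $ j / y $ i"
      unfolding \<delta>_def by (intro Min_le) (auto intro!: rev_image_eqI [of "(i, j)"])
    thus ?thesis using y(1) [of i] by (simp add: field_simps)
  qed
  have "\<delta> * (\<Sum>v\<in>UNIV. y $ v) * r ^ m \<le> real (card (paths_to src rng (m + k) w))" for m w
  proof -
    have "\<delta> * (\<Sum>v\<in>UNIV. y $ v) * r ^ m =
        (\<Sum>v\<in>UNIV. real (card (paths_to src rng m v)) * (\<delta> * y $ v))"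
      using card_paths_to_right_eigenvector [of src rng y r m] y(2)
      by (simp add: B_def algebra_simps flip: sum_distrib_left)
    also have "\<dots> \<le> (\<Sum>v\<in>UNIV. real (card (paths_to src rng m v)) * (((**) B ^^ k) (mat 1)) $ v $ w)"
      by (intro sum_mono mult_left_mono \<delta>) auto
    also have "\<dots> = real (card (paths_to src rng (m + k) w))"
      unfolding B_def by (rule card_paths_to_add [symmetric])
    finally show ?thesis .
  qed
  moreover have "\<delta> * (\<Sum>v\<in>UNIV. y $ v) > 0"
    using \<open>\<delta> > 0\<close> y(1) by (intro mult_pos_pos sum_pos) auto
  ultimately show ?thesis using that by blast
qed

section \<open>Diagonal entries of functions of a weighted involution\<close>

lemma l2_inner_finite:
  assumes "finite F" "F \<subseteq> X" "\<And>y. y \<in> X - F \<Longrightarrow> f y = 0 \<or> g y = 0"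
  shows "l2_inner X f g = (\<Sum>y\<in>F. cnj (f y) * g y)"
proof -
  have "l2_inner X f g = (\<Sum>\<^sub>\<infinity>y\<in>F. cnj (f y) * g y)"
    unfolding l2_inner_def using assms by (intro infsum_cong_neutral) auto
  thus ?thesis using assms(1) by simp
qed

lemma finite_support_in_l2:
  assumes "finite F" "F \<subseteq> X" "\<And>y. y \<notin> F \<Longrightarrow> f y = 0"
  shows "f \<in> l2 X"
proof -
  have "(\<lambda>x. (cmod (f x))\<^sup>2) summable_on X"
    by (rule finite_nonzero_values_imp_summable_on, rule finite_subset [OF _ assms(1)])
       (use assms(3) in auto)
  thus ?thesis using assms by (auto simp: l2_def)
qed

text \<open>The abstract form of the Dirac operator: on each two-point orbit of
  \<open>\<sigma>\<close> it is \<open>w\<close> times the swap, with eigenvalues \<open>w\<close>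
  and \<open>- w\<close>.\<close>

locale weighted_swap =
  fixes X :: "'x set" and \<sigma> :: "'x \<Rightarrow> 'x" and w :: "'x \<Rightarrow> real"
    and T :: "('x \<Rightarrow> complex) \<Rightarrow> 'x \<Rightarrow> complex"
  assumes T: "T \<phi> x = (if x \<in> X then complex_of_real (w x) * \<phi> (\<sigma> x) else 0)"
    and \<sigma>: "x \<in> X \<Longrightarrow> \<sigma> x \<in> X" "x \<in> X \<Longrightarrow> \<sigma> (\<sigma> x) = x" "x \<in> X \<Longrightarrow> \<sigma> x \<noteq> x"
    and w: "x \<in> X \<Longrightarrow> w x > 0" "x \<in> X \<Longrightarrow> w (\<sigma> x) = w x"
begin

text \<open>The candidate for the orthogonal projection of \<open>delta x\<close> onto the
  eigenspace of \<open>\<mu>\<close>: the even or the odd half on the orbit of \<open>x\<close>,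
  according to the sign of \<open>\<mu>\<close>.\<close>

definition eigenproj_delta :: "real \<Rightarrow> 'x \<Rightarrow> 'x \<Rightarrow> complex" where
  "eigenproj_delta \<mu> x =
     (\<lambda>y. if \<bar>\<mu>\<bar> = w x then (delta x y + of_real (sgn \<mu>) * delta (\<sigma> x) y) / 2 else 0)"

lemma eigenspace_outside:
  assumes "\<xi> \<in> op_eigenspace X T \<mu>" "y \<notin> X"
  shows "\<xi> y = 0"
  using assms by (simp add: op_eigenspace_def l2_def)

lemma eigenspace_swap:
  assumes "\<xi> \<in> op_eigenspace X T \<mu>" "y \<in> X"
  shows "of_real (w y) * \<xi> (\<sigma> y) = of_real \<mu> * \<xi> y"
  using assms T [of \<xi> y] by (simp add: op_eigenspace_def)

text \<open>Using the eigenvalue equation at \<open>y\<close> and at \<open>\<sigma> y\<close>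
  multiplies \<open>\<xi> y\<close> by both \<open>w y * w y\<close> and
  \<open>\<mu> * \<mu>\<close>, so an eigenvector lives on orbits of weight
  \<open>\<bar>\<mu>\<bar>\<close>.\<close>

lemma eigenspace_weight_neq:
  assumes \<xi>: "\<xi> \<in> op_eigenspace X T \<mu>" and y: "y \<in> X" "\<bar>\<mu>\<bar> \<noteq> w y"
  shows "\<xi> y = 0"
proof -
  have swap: "of_real (w y) * \<xi> (\<sigma> y) = of_real \<mu> * \<xi> y"
    "of_real (w y) * \<xi> y = of_real \<mu> * \<xi> (\<sigma> y)"
    using eigenspace_swap [OF \<xi> y(1)] eigenspace_swap [OF \<xi> \<sigma>(1) [OF y(1)]] \<sigma> w y(1) by simp_all
  have "of_real (w y * w y) * \<xi> y = of_real (w y) * (of_real (w y) * \<xi> y)" by simp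
  also have "\<dots> = of_real \<mu> * (of_real (w y) * \<xi> (\<sigma> y))" by (subst swap(2)) simp
  also have "\<dots> = of_real (\<mu> * \<mu>) * \<xi> y" by (subst swap(1)) simp
  finally have "of_real (w y * w y) * \<xi> y = of_real (\<mu> * \<mu>) * \<xi> y" .
  moreover have "w y * w y \<noteq> \<mu> * \<mu>"
    using y w(1) [OF y(1)] by (auto simp: power2_eq_square [symmetric] abs_eq_iff power2_eq_iff)
  ultimately show ?thesis by (metis mult_right_cancel of_real_eq_iff)
qed

lemma eigenspace_weight_eq:
  assumes \<xi>: "\<xi> \<in> op_eigenspace X T \<mu>" and y: "y \<in> X" "\<bar>\<mu>\<bar> = w y"
  shows "\<xi> (\<sigma> y) = of_real (sgn \<mu>) * \<xi> y"
proof -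
  have "of_real (w y) * \<xi> (\<sigma> y) = of_real (w y) * (of_real (sgn \<mu>) * \<xi> y)"
    using eigenspace_swap [OF \<xi> y(1)] by (simp flip: y(2) of_real_mult mult.assoc add: abs_mult_sgn)
  thus ?thesis using w(1) [OF y(1)] by simp
qed

lemma eigenproj_delta_in_eigenspace:
  assumes x: "x \<in> X"
  shows "eigenproj_delta \<mu> x \<in> op_eigenspace X T \<mu>"
proof -
  have "eigenproj_delta \<mu> x \<in> l2 X"
    using x \<sigma> by (intro finite_support_in_l2 [of "{x, \<sigma> x}"]) (auto simp: eigenproj_delta_def delta_def)
  moreover have "T (eigenproj_delta \<mu> x) y = of_real \<mu> * eigenproj_delta \<mu> x y" for y
  proof (cases "y \<in> X \<and> \<bar>\<mu>\<bar> = w x")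
    case True
    hence \<mu>: "of_real (w x) = (of_real \<mu> * of_real (sgn \<mu>) :: complex)"
      "of_real (sgn \<mu>) * of_real (sgn \<mu>) = (1 :: complex)"
      using w(1) [OF x] by (auto simp: sgn_if simp flip: of_real_mult split: if_splits)
    consider "y = x" | "y = \<sigma> x" | "y \<noteq> x" "y \<noteq> \<sigma> x" by blast
    thus ?thesis
    proof cases
      case 3
      moreover from this have "\<sigma> y \<noteq> x" "\<sigma> y \<noteq> \<sigma> x" using \<sigma> True x by metis+
      ultimately show ?thesis by (simp add: T eigenproj_delta_def delta_def)
    qed (use True \<mu> \<sigma> [OF x] \<sigma>(3) [OF x, symmetric] w [OF x] in
        \<open>simp_all add: T eigenproj_delta_def delta_def mult.assoc\<close>)
  next
    case False
    thus ?thesis using x \<sigma> by (auto simp: T eigenproj_delta_def delta_def)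
  qed
  ultimately show ?thesis by (auto simp: op_eigenspace_def)
qed

lemma l2_inner_eigenproj_delta:
  assumes "y \<in> X" "\<bar>\<mu>\<bar> = w y"
  shows "l2_inner X (eigenproj_delta \<mu> y) g = (g y + of_real (sgn \<mu>) * g (\<sigma> y)) / 2"
proof -
  have "l2_inner X (eigenproj_delta \<mu> y) g = (\<Sum>u\<in>{y, \<sigma> y}. cnj (eigenproj_delta \<mu> y u) * g u)"
    using assms \<sigma> by (intro l2_inner_finite) (auto simp: eigenproj_delta_def delta_def)
  thus ?thesis using assms \<sigma>(3) [of y] by (auto simp: eigenproj_delta_def delta_def field_simps)
qed

text \<open>On an orbit an eigenvector is determined by one value, which makes the residual of the
  candidate orthogonal to the eigenspace. Any other candidate is compared with it by testing against
  the eigenvectors \<open>eigenproj_delta \<mu> y\<close>.\<close>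

lemma l2_proj_eigenspace_delta:
  assumes x: "x \<in> X"
  shows "l2_proj X (op_eigenspace X T \<mu>) (delta x) = eigenproj_delta \<mu> x"
  unfolding l2_proj_def
proof (rule the_equality, safe)
  show "eigenproj_delta \<mu> x \<in> op_eigenspace X T \<mu>" by (rule eigenproj_delta_in_eigenspace [OF x])
next
  fix \<xi> assume \<xi>: "\<xi> \<in> op_eigenspace X T \<mu>"
  have "l2_inner X \<xi> (\<lambda>y. delta x y - eigenproj_delta \<mu> x y) =
      (\<Sum>y\<in>{x, \<sigma> x}. cnj (\<xi> y) * (delta x y - eigenproj_delta \<mu> x y))"
    using x \<sigma> by (intro l2_inner_finite) (auto simp: eigenproj_delta_def delta_def)
  also have "\<dots> = cnj (\<xi> x) * (1 - eigenproj_delta \<mu> x x) - cnj (\<xi> (\<sigma> x)) * eigenproj_delta \<mu> x (\<sigma> x)"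
    using \<sigma>(3) [OF x] by (auto simp: delta_def)
  also have "\<dots> = 0"
  proof (cases "\<bar>\<mu>\<bar> = w x")
    case True
    hence "of_real (sgn \<mu>) * of_real (sgn \<mu>) = (1 :: complex)"
      using w(1) [OF x] by (auto simp: sgn_if simp flip: of_real_mult split: if_splits)
    thus ?thesis
      using True \<sigma>(3) [OF x] eigenspace_weight_eq [OF \<xi> x True]
      by (auto simp: eigenproj_delta_def delta_def)
  next
    case False
    thus ?thesis using eigenspace_weight_neq [OF \<xi> x False] by (simp add: eigenproj_delta_def)
  qed
  finally show "l2_inner X \<xi> (\<lambda>y. delta x y - eigenproj_delta \<mu> x y) = 0" .
next
  fix \<psi>
  assume \<psi>: "\<psi> \<in> op_eigenspace X T \<mu>"
    and orth: "\<forall>\<xi>\<in>op_eigenspace X T \<mu>. l2_inner X \<xi> (\<lambda>y. delta x y - \<psi> y) = 0"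
  note proj = eigenproj_delta_in_eigenspace [OF x, of \<mu>]
  have "\<psi> y = eigenproj_delta \<mu> x y" for y
  proof (cases "y \<in> X \<and> \<bar>\<mu>\<bar> = w y")
    case True
    hence y: "y \<in> X" "\<bar>\<mu>\<bar> = w y" by auto
    have sgn: "of_real (sgn \<mu>) * of_real (sgn \<mu>) = (1 :: complex)"
      using w(1) [OF y(1)] y by (auto simp: sgn_if simp flip: of_real_mult split: if_splits)
    \<comment> \<open>The test against \<open>eigenproj_delta \<mu> y\<close> involves only
      \<open>y\<close> and \<open>\<sigma> y\<close>; as \<open>\<psi> (\<sigma> y)\<close> is a
      known multiple of \<open>\<psi> y\<close>, it reads off \<open>\<psi> y\<close>.\<close>
    have "(delta x y - \<psi> y + of_real (sgn \<mu>) * (delta x (\<sigma> y) - \<psi> (\<sigma> y))) / 2 = 0"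
      using orth eigenproj_delta_in_eigenspace [OF y(1), of \<mu>] l2_inner_eigenproj_delta [OF y] by metis
    hence "2 * \<psi> y = delta x y + of_real (sgn \<mu>) * delta x (\<sigma> y)"
      using sgn by (simp add: eigenspace_weight_eq [OF \<psi> y] algebra_simps)
    moreover have "delta x (\<sigma> y) = delta (\<sigma> x) y"
      using \<sigma> x y(1) by (auto simp: delta_def)
    moreover have "2 * eigenproj_delta \<mu> x y = delta x y + of_real (sgn \<mu>) * delta (\<sigma> x) y"
      using y w x by (auto simp: eigenproj_delta_def delta_def)
    ultimately have "2 * \<psi> y = 2 * eigenproj_delta \<mu> x y" by simp
    thus ?thesis by simp
  next
    case False
    thus ?thesis
      using eigenspace_outside [OF \<psi>] eigenspace_outside [OF proj]
        eigenspace_weight_neq [OF \<psi>] eigenspace_weight_neq [OF proj] by metis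
  qed
  thus "\<psi> = eigenproj_delta \<mu> x" by blast
qed

text \<open>Only the eigenvalues \<open>w x\<close> and \<open>- w x\<close> see
  \<open>delta x\<close>, each carrying half of its squared norm.\<close>

lemma diag_entry_op_fun:
  assumes x: "x \<in> X"
  shows "diag_entry X (op_fun X f T) x = (f (w x) + f (- w x)) / 2"
proof -
  have proj: "eigenproj_delta \<mu> x x = (if \<bar>\<mu>\<bar> = w x then 1 / 2 else 0)" for \<mu>
    using \<sigma>(3) [OF x] by (auto simp: eigenproj_delta_def delta_def)
  have "\<mu> \<in> point_spectrum X T" if "\<bar>\<mu>\<bar> = w x" for \<mu>
  proof -
    have "eigenproj_delta \<mu> x \<noteq> (\<lambda>_. 0)" using proj [of \<mu>] that by auto
    thus ?thesis
      using eigenproj_delta_in_eigenspace [OF x, of \<mu>] by (auto simp: point_spectrum_def)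
  qed
  hence sub: "{w x, - w x} \<subseteq> point_spectrum X T" using w(1) [OF x] by auto
  have "diag_entry X (op_fun X f T) x = op_fun X f T (delta x) x"
  proof -
    have "diag_entry X (op_fun X f T) x = (\<Sum>y\<in>{x}. cnj (delta x y) * op_fun X f T (delta x) y)"
      unfolding diag_entry_def using x by (intro l2_inner_finite) (auto simp: delta_def)
    thus ?thesis by (simp add: delta_def)
  qed
  also have "\<dots> = (\<Sum>\<^sub>\<infinity>\<mu>\<in>point_spectrum X T. f \<mu> * eigenproj_delta \<mu> x x)"
    by (simp add: op_fun_def l2_proj_eigenspace_delta [OF x])
  also have "\<dots> = (\<Sum>\<^sub>\<infinity>\<mu>\<in>{w x, - w x}. f \<mu> * eigenproj_delta \<mu> x x)"
    using sub by (intro infsum_cong_neutral) (auto simp: proj)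
  also have "\<dots> = (f (w x) + f (- w x)) / 2"
    using w(1) [OF x] by (simp add: proj add_divide_distrib)
  finally show ?thesis .
qed

lemma diag_entry_op_abs_cpower:
  assumes "x \<in> X"
  shows "diag_entry X (op_abs_cpower X T s) x = of_real (w x) powr s"
  using diag_entry_op_fun [OF assms, of "\<lambda>\<mu>. of_real \<bar>\<mu>\<bar> powr s"] w(1) [OF assms] by (simp add: op_abs_cpower_def)

end

section \<open>Edges of level n and the zeta series\<close>

lemma tau_inj_on_length:
  assumes "tau th p = tau th q" "length p = length q"
  shows "p = q"
proof (rule nth_equalityI)
  fix i assume "i < length p"
  thus "p ! i = q ! i" using fun_cong [OF assms(1), of i] assms(2) by (simp add: tau_def)
qed (fact assms(2))

lemma E_level_Suc:
  "E_level src rng th H (Suc m) =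
     (\<lambda>((\<epsilon>, \<epsilon>'), \<eta>). (tau th (\<eta> @ [\<epsilon>]), tau th (\<eta> @ [\<epsilon>']))) `
       (SIGMA h:H. paths_to src rng m (src (fst h)))"
  by (force simp: E_level_def paths_to_def is_path_snoc image_iff)

text \<open>For paths of a fixed length the extension by \<open>tau\<close> loses nothing, so the
  parametrization by a pair in \<open>H\<close> and a path into its common source is
  injective.\<close>

lemma
  fixes src rng :: "'e::finite \<Rightarrow> 'v"
  shows finite_E_level: "finite (E_level src rng th H (Suc m))"
    and card_E_level: "card (E_level src rng th H (Suc m)) =
      (\<Sum>h\<in>H. card (paths_to src rng m (src (fst h))))"
proof -
  have "inj_on (\<lambda>((\<epsilon>, \<epsilon>'), \<eta>). (tau th (\<eta> @ [\<epsilon>]), tau th (\<eta> @ [\<epsilon>'])))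
      (SIGMA h:H. paths_to src rng m (src (fst h)))"
    by (rule inj_onI) (auto simp: paths_to_def dest!: tau_inj_on_length)
  thus "card (E_level src rng th H (Suc m)) = (\<Sum>h\<in>H. card (paths_to src rng m (src (fst h))))"
    unfolding E_level_Suc by (simp add: card_image finite_paths_to)
  show "finite (E_level src rng th H (Suc m))"
    unfolding E_level_Suc by (intro finite_imageI finite_SigmaI finite_paths_to finite)
qed

text \<open>The pair from \<open>H\<close> sits at index \<open>m\<close>, after a common path of
  length \<open>m\<close>. The first index where the two infinite paths part therefore recovers the
  level.\<close>

lemma E_level_first_difference:
  assumes "e \<in> E_level src rng th H (Suc m)" and irr: "\<And>\<epsilon>. (\<epsilon>, \<epsilon>) \<notin> H"
  shows "fst e m \<noteq> snd e m" "i < m \<Longrightarrow> fst e i = snd e i"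
  using assms(1) irr by (auto simp: E_level_def tau_def nth_append)

lemma E_level_disjoint:
  assumes "e \<in> E_level src rng th H (Suc m)" "e \<in> E_level src rng th H (Suc n)"
    and irr: "\<And>\<epsilon>. (\<epsilon>, \<epsilon>) \<notin> H"
  shows "m = n"
  using E_level_first_difference [OF assms(1) irr] E_level_first_difference [OF assms(2) irr]
  by (metis linorder_neqE_nat)

lemma E_all_eq: "E_all src rng th H = (\<Union>m. E_level src rng th H (Suc m))"
  unfolding E_all_def by (auto simp: Suc_le_eq gr0_conv_Suc)

lemma level_eq:
  assumes "e \<in> E_level src rng th H (Suc m)" and irr: "\<And>\<epsilon>. (\<epsilon>, \<epsilon>) \<notin> H"
  shows "level src rng th H e = Suc m"
  unfolding level_def
proof (rule the_equality)
  fix n assume "n \<ge> 1 \<and> e \<in> E_level src rng th H n"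
  thus "n = Suc m" using E_level_disjoint [OF _ assms(1) irr] by (cases n) auto
qed (use assms(1) in auto)

lemma E_level_swap:
  assumes "e \<in> E_level src rng th H (Suc m)" and "sym H"
    and src: "\<And>\<epsilon> \<epsilon>'. (\<epsilon>, \<epsilon>') \<in> H \<Longrightarrow> src \<epsilon> = src \<epsilon>'"
  shows "prod.swap e \<in> E_level src rng th H (Suc m)"
proof -
  obtain \<eta> \<epsilon> \<epsilon>' where e: "e = (tau th (\<eta> @ [\<epsilon>]), tau th (\<eta> @ [\<epsilon>']))" "length \<eta> = m"
    "is_path src rng (\<eta> @ [\<epsilon>])" "(\<epsilon>, \<epsilon>') \<in> H"
    using assms(1) by (auto simp: E_level_def)
  have "is_path src rng (\<eta> @ [\<epsilon>'])" using e(3) src [OF e(4)] by (auto simp: is_path_snoc)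
  moreover have "(\<epsilon>', \<epsilon>) \<in> H" using e(4) \<open>sym H\<close> by (rule symD [rotated])
  ultimately show ?thesis using e(1,2) by (fastforce simp: E_level_def)
qed

lemma of_real_pos_cpowr: "a > 0 \<Longrightarrow> complex_of_real a powr s = exp (s * complex_of_real (ln a))"
  by (simp add: powr_def Ln_of_real)

section \<open>The trace as a sum over levels\<close>

locale horizontal_edges =
  fixes src rng :: "'e::finite \<Rightarrow> 'v::finite" and th :: "'e \<Rightarrow> 'e" and H :: "('e \<times> 'e) set"
    and \<rho> :: real
  assumes H_sub: "H \<subseteq> {(\<epsilon>, \<epsilon>'). \<epsilon> \<noteq> \<epsilon>' \<and> src \<epsilon> = src \<epsilon>'}" and H_sym: "sym H" and rho_pos: "\<rho> > 0"
begin

abbreviation "E \<equiv> E_all src rng th H"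
text \<open>The index is the length of the common path, one less than the level; hence the exponents
  \<open>Suc m\<close> below.\<close>

abbreviation "E' \<equiv> \<lambda>m. E_level src rng th H (Suc m)"
abbreviation "lev \<equiv> level src rng th H"

lemma H_irrefl: "(\<epsilon>, \<epsilon>) \<notin> H"
  using H_sub by auto

lemma weighted_swap_dirac:
  "weighted_swap E prod.swap (\<lambda>e. inverse \<rho> ^ lev e) (dirac src rng th H \<rho>)"
proof
  fix e assume "e \<in> E"
  then obtain m where e: "e \<in> E' m" by (auto simp: E_all_eq)
  have e': "prod.swap e \<in> E' m"
    using H_sub by (intro E_level_swap [OF e H_sym]) auto
  thus "prod.swap e \<in> E" by (auto simp: E_all_eq)
  show "inverse \<rho> ^ lev (prod.swap e) = inverse \<rho> ^ lev e"
    using e e' H_irrefl by (simp add: level_eq)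
  show "prod.swap e \<noteq> e"
    using E_level_first_difference(1) [OF e H_irrefl] by (cases e) auto
qed (use rho_pos in \<open>auto simp: dirac_def of_real_inverse\<close>)

lemma diag_entry_dirac:
  assumes "e \<in> E' m"
  shows "diag_entry E (op_abs_cpower E (dirac src rng th H \<rho>) (- z)) e =
    (complex_of_real \<rho> powr z) ^ Suc m"
proof -
  interpret weighted_swap E prod.swap "\<lambda>e. inverse \<rho> ^ lev e" "dirac src rng th H \<rho>"
    by (rule weighted_swap_dirac)
  have "diag_entry E (op_abs_cpower E (dirac src rng th H \<rho>) (- z)) e =
      complex_of_real (inverse \<rho> ^ Suc m) powr (- z)"
    using assms by (subst diag_entry_op_abs_cpower) (auto simp: E_all_eq level_eq [OF assms H_irrefl])
  \<comment> \<open>For a positive real base \<open>powr\<close> is the exponential of the real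
    logarithm, so the level can be pulled out as an exponent without any question of
    branches.\<close>
  also have "\<dots> = exp (- z * complex_of_real (ln (inverse \<rho> ^ Suc m)))"
    using rho_pos by (intro of_real_pos_cpowr) simp
  also have "ln (inverse \<rho> ^ Suc m) = - (real (Suc m) * ln \<rho>)"
    using rho_pos by (subst ln_realpow) (auto simp: ln_inverse)
  also have "exp (- z * complex_of_real (- (real (Suc m) * ln \<rho>))) =
      exp (of_nat (Suc m) * (z * complex_of_real (ln \<rho>)))"
    by (simp add: algebra_simps)
  also have "\<dots> = (complex_of_real \<rho> powr z) ^ Suc m"
    by (simp add: of_real_pos_cpowr [OF rho_pos] exp_of_nat_mult del: power_Suc of_nat_Suc)
  finally show ?thesis .
qed

text \<open>The diagonal entries are constant on each finite level, so summing their norms over a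
  level gives the norm of one term of the series. Absolute summability over all edges follows, and
  it permits grouping by levels.\<close>

lemma zeta_series:
  fixes z S :: complex
  defines "q \<equiv> complex_of_real \<rho> powr z"
  assumes "((\<lambda>m. of_nat (card (E' m)) * q ^ Suc m) has_sum S) UNIV"
  shows "zeta_converges src rng th H \<rho> z" "zeta_trace src rng th H \<rho> z = S"
proof -
  define g where "g = diag_entry E (op_abs_cpower E (dirac src rng th H \<rho>) (- z))"
  have g: "g e = q ^ Suc m" if "e \<in> E' m" for e m
    unfolding g_def q_def by (rule diag_entry_dirac [OF that])
  have E: "E = snd ` (SIGMA m:UNIV. E' m)" by (force simp: E_all_eq)
  have inj: "inj_on snd (SIGMA m:UNIV. E' m)"
    by (rule inj_onI) (auto dest: E_level_disjoint [OF _ _ H_irrefl])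
  have "(\<lambda>m. norm (of_nat (card (E' m)) * q ^ Suc m)) summable_on UNIV"
    using assms(2) unfolding summable_on_iff_abs_summable_on_complex [symmetric] by (rule has_sum_imp_summable)
  also have "(\<lambda>m. norm (of_nat (card (E' m)) * q ^ Suc m)) =
      (\<lambda>m. norm (infsum (\<lambda>e. norm ((g \<circ> snd) (m, e))) (E' m)))"
    by (simp add: g finite_E_level norm_mult norm_power cong: sum.cong)
  finally have "(\<lambda>x. norm ((g \<circ> snd) x)) summable_on (SIGMA m:UNIV. E' m)"
    by (subst Infinite_Sum.abs_summable_on_Sigma_iff) (auto simp: finite_E_level intro: summable_on_finite)
  hence "(g \<circ> snd) summable_on (SIGMA m:UNIV. E' m)"
    by (rule abs_summable_summable)
  moreover have "((\<lambda>e. (g \<circ> snd) (m, e)) has_sum of_nat (card (E' m)) * q ^ Suc m) (E' m)" for m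
    by (rule has_sum_finiteI) (auto simp: g finite_E_level)
  ultimately have "((g \<circ> snd) has_sum S) (SIGMA m:UNIV. E' m)"
    using assms(2) by (intro has_sum_SigmaI [where g = "\<lambda>m. of_nat (card (E' m)) * q ^ Suc m"])
  hence "(g has_sum S) E"
    unfolding E has_sum_reindex [OF inj] .
  thus "zeta_converges src rng th H \<rho> z" "zeta_trace src rng th H \<rho> z = S"
    by (auto simp: zeta_converges_def zeta_trace_def op_trace_def Let_def g_def has_sum_imp_summable infsumI)
qed

text \<open>Summability in the complex numbers is absolute, and a single level is a finite part of
  the sum of norms.\<close>

lemma zeta_converges_imp_bounded:
  assumes "zeta_converges src rng th H \<rho> z"
  obtains K where "\<And>m. real (card (E' m)) * cmod (complex_of_real \<rho> powr z) ^ Suc m \<le> K"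
proof -
  define g where "g = diag_entry E (op_abs_cpower E (dirac src rng th H \<rho>) (- z))"
  have sum: "(\<lambda>e. norm (g e)) summable_on E"
    using assms unfolding zeta_converges_def Let_def g_def summable_on_iff_abs_summable_on_complex .
  have "real (card (E' m)) * cmod (complex_of_real \<rho> powr z) ^ Suc m \<le> (\<Sum>\<^sub>\<infinity>e\<in>E. norm (g e))" for m
  proof -
    have "real (card (E' m)) * cmod (complex_of_real \<rho> powr z) ^ Suc m = (\<Sum>e\<in>E' m. norm (g e))"
      by (simp add: g_def diag_entry_dirac norm_power norm_mult)
    also have "\<dots> \<le> (\<Sum>\<^sub>\<infinity>e\<in>E. norm (g e))"
      by (rule finite_sum_le_infsum [OF sum finite_E_level]) (auto simp: E_all_eq)
    finally show ?thesis .
  qed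
  thus ?thesis by (rule that)
qed

end

section \<open>Spectral resolution and exponential poles\<close>

text \<open>The map \<open>\<Phi>\<close> expands \<open>x\<close> in the vectors
  \<open>R j l\<close> with coefficients from the pairing with \<open>L j l\<close>. It fixes each
  \<open>R j l\<close> by biorthogonality, hence every vector as these span; the claim is its
  matrix.\<close>

lemma biorthogonal_resolution:
  fixes A :: "complex ^ 'n ^ 'n" and R L :: "'j \<Rightarrow> 'l \<Rightarrow> complex ^ 'n"
  assumes diag: "diagonalizable_matrix A" and "finite J" and fin: "\<And>j. j \<in> J \<Longrightarrow> finite (I j)"
    and lam: "eigenvalues A \<subseteq> lam ` J"
    and R: "\<And>j. j \<in> J \<Longrightarrow> right_eigenspace A (lam j) \<subseteq> vec.span (R j ` I j)"
    and RL: "\<And>j l j' l'. \<lbrakk>j \<in> J; l \<in> I j; j' \<in> J; l' \<in> I j'\<rbrakk> \<Longrightarrow>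
          (\<Sum>v\<in>UNIV. R j l $ v * L j' l' $ v) = (if j = j' \<and> l = l' then 1 else 0)"
  shows "(\<Sum>j\<in>J. \<Sum>l\<in>I j. R j l $ v * L j l $ w) = (if v = w then 1 else 0)"
proof -
  define S where "S = (\<Union>j\<in>J. R j ` I j)"
  \<comment> \<open>Bilinear, without conjugation, as in the normalization of the
    eigenbases.\<close>
  define pair :: "complex ^ 'n \<Rightarrow> complex ^ 'n \<Rightarrow> complex"
    where "pair x y = (\<Sum>v\<in>UNIV. x $ v * y $ v)" for x y
  define \<Phi> where "\<Phi> x v = (\<Sum>j\<in>J. \<Sum>l\<in>I j. pair x (L j l) * R j l $ v)" for x v
  have "(\<Union>\<mu>\<in>eigenvalues A. right_eigenspace A \<mu>) \<subseteq> vec.span S"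
  proof safe
    fix \<mu> x assume "\<mu> \<in> eigenvalues A" "x \<in> right_eigenspace A \<mu>"
    then obtain j where "j \<in> J" "x \<in> vec.span (R j ` I j)" using lam R by blast
    thus "x \<in> vec.span S" using vec.span_mono [of "R j ` I j" S] by (auto simp: S_def)
  qed
  hence "vec.span (\<Union>\<mu>\<in>eigenvalues A. right_eigenspace A \<mu>) \<subseteq> vec.span S"
    by (rule vec.span_minimal) (rule vec.subspace_span)
  hence span: "x \<in> vec.span S" for x
    using diagonalizable_span_eigenvectors [OF diag] by blast
  have \<Phi>: "\<Phi> x v = x $ v" for x v
    using span [of x]
  proof (induction rule: vec.span_induct_alt)
    case base
    show ?case by (simp add: \<Phi>_def pair_def)
  next
    case (step c x y)
    then obtain j l where jl: "j \<in> J" "l \<in> I j" "x = R j l" by (auto simp: S_def)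
    have "\<Phi> x v = (\<Sum>j'\<in>J. \<Sum>l'\<in>I j'. if j = j' \<and> l = l' then R j l $ v else 0)"
      unfolding \<Phi>_def by (intro sum.cong refl) (use jl in \<open>auto simp: pair_def RL\<close>)
    also have "\<dots> = (\<Sum>j'\<in>J. if j = j' then R j l $ v else 0)"
      by (intro sum.cong refl) (use jl fin in \<open>auto simp: sum.delta\<close>)
    also have "\<dots> = x $ v" using jl \<open>finite J\<close> by simp
    finally have "\<Phi> x v = x $ v" .
    moreover have "pair (c *s x + y) u = c * pair x u + pair y u" for u
      by (simp add: pair_def sum.distrib sum_distrib_left algebra_simps)
    hence "\<Phi> (c *s x + y) v = c * \<Phi> x v + \<Phi> y v"
      by (simp add: \<Phi>_def sum.distrib sum_distrib_left algebra_simps)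
    ultimately show ?case using step by simp
  qed
  have "pair (axis w 1) u = u $ w" for u
  proof -
    have "pair (axis w 1) u = (\<Sum>v\<in>{w}. axis w 1 $ v * u $ v)"
      unfolding pair_def by (rule sum.mono_neutral_right) (auto simp: axis_def)
    thus ?thesis by simp
  qed
  thus ?thesis using \<Phi> [of "axis w 1" v] by (simp add: \<Phi>_def axis_def mult.commute)
qed

text \<open>Inserting the resolution of the identity at the end vertex \<open>w\<close> expands the
  count in right eigenvectors, on which the recursion for paths is diagonal.\<close>

lemma card_paths_to_spectral:
  fixes src rng :: "'e::finite \<Rightarrow> 'v::finite" and R L :: "'j \<Rightarrow> 'l \<Rightarrow> complex ^ 'v"
  assumes eig: "\<And>j l. \<lbrakk>j \<in> J; l \<in> I j\<rbrakk> \<Longrightarrow> graph_matrix src rng *v R j l = lam j *s R j l"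
    and resolution: "\<And>v w. (\<Sum>j\<in>J. \<Sum>l\<in>I j. R j l $ v * L j l $ w) = (if v = w then 1 else 0)"
  shows "of_nat (card (paths_to src rng m w)) =
    (\<Sum>j\<in>J. lam j ^ m * (\<Sum>l\<in>I j. \<Sum>v\<in>UNIV. R j l $ v * L j l $ w))"
proof -
  have "of_nat (card (paths_to src rng m w)) =
      (\<Sum>v\<in>UNIV. of_nat (card (paths_to src rng m v)) * (if v = w then 1 else 0 :: complex))"
    by (simp add: if_distrib cong: if_cong)
  also have "\<dots> = (\<Sum>v\<in>UNIV. \<Sum>j\<in>J. \<Sum>l\<in>I j.
      of_nat (card (paths_to src rng m v)) * R j l $ v * L j l $ w)"
    by (simp add: resolution [symmetric] sum_distrib_left mult.assoc)
  also have "\<dots> = (\<Sum>j\<in>J. \<Sum>l\<in>I j. \<Sum>v\<in>UNIV.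
      of_nat (card (paths_to src rng m v)) * R j l $ v * L j l $ w)"
    by (subst sum.swap, intro sum.cong refl, rule sum.swap)
  also have "\<dots> = (\<Sum>j\<in>J. \<Sum>l\<in>I j. lam j ^ m * (\<Sum>v\<in>UNIV. R j l $ v) * L j l $ w)"
    by (intro sum.cong refl) (simp add: card_paths_to_right_eigenvector [OF eig] flip: sum_distrib_right)
  also have "\<dots> = (\<Sum>j\<in>J. lam j ^ m * (\<Sum>l\<in>I j. \<Sum>v\<in>UNIV. R j l $ v * L j l $ w))"
    by (simp add: sum_distrib_left sum_distrib_right mult.assoc)
  finally show ?thesis .
qed

section \<open>Sums of geometric series and their meromorphic continuation\<close>

lemma has_sum_exponential_sum:
  fixes a x :: "'j \<Rightarrow> complex"
  assumes "finite J" "\<And>j. j \<in> J \<Longrightarrow> cmod (x j) < 1"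
  shows "((\<lambda>m. \<Sum>j\<in>J. a j * x j ^ m) has_sum (\<Sum>j\<in>J. a j / (1 - x j))) UNIV"
  using assms
proof (induction J rule: finite_induct)
  case (insert j J)
  have "((\<lambda>m. x j ^ m) has_sum (1 / (1 - x j))) UNIV"
    using insert.prems by (intro norm_summable_imp_has_sum geometric_sums) (auto simp: norm_power summable_geometric)
  hence "((\<lambda>m. a j * x j ^ m) has_sum (a j * (1 / (1 - x j)))) UNIV"
    by (rule has_sum_cmult_right)
  from has_sum_add [OF this insert.IH] insert show ?case by simp
qed simp

text \<open>The shape of the zeta function, with \<open>a\<close> for \<open>ln \<rho>\<close>.
  Since \<open>\<mu>\<close> is injective, at most one term is singular at a given point;
  coefficients \<open>c j\<close> equal to 0 are allowed and produce no pole.\<close>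

locale exponential_poles =
  fixes J :: "'j set" and \<mu> c :: "'j \<Rightarrow> complex" and a :: complex and g :: "complex \<Rightarrow> complex"
  assumes fin: "finite J" and inj: "inj_on \<mu> J" and a: "a \<noteq> 0" and g: "g holomorphic_on UNIV"
begin

definition F :: "complex \<Rightarrow> complex" where
  "F z = (\<Sum>j\<in>J. c j / (1 - \<mu> j * exp (a * z))) + g z"

lemma g_analytic: "g analytic_on S"
  using g analytic_on_open [of UNIV g] analytic_on_subset by blast

lemma term_analytic:
  assumes "c j \<noteq> 0 \<Longrightarrow> \<mu> j * exp (a * z) \<noteq> 1"
  shows "(\<lambda>z. c j / (1 - \<mu> j * exp (a * z))) analytic_on {z}"
  using assms by (cases "c j = 0") (auto intro!: analytic_intros)

lemma F_analytic:
  assumes "\<And>j. \<lbrakk>j \<in> J; c j \<noteq> 0\<rbrakk> \<Longrightarrow> \<mu> j * exp (a * z) \<noteq> 1"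
  shows "F analytic_on {z}"
  unfolding F_def using assms by (intro analytic_intros term_analytic g_analytic) auto

lemma F_meromorphic: "F meromorphic_on S"
  unfolding F_def by (intro meromorphic_intros analytic_on_imp_meromorphic_on g_analytic analytic_intros)

text \<open>Near \<open>z\<close> all terms but the \<open>j\<close>-th are analytic and are
  collected in \<open>G\<close>. Over the denominator \<open>D\<close>, which has derivative
  \<open>- a\<close> at \<open>z\<close>, the sum becomes a quotient with a simple zero below and
  \<open>c j\<close> above.\<close>

lemma
  assumes j: "j \<in> J" "\<mu> j * exp (a * z) = 1" and "c j \<noteq> 0"
  shows F_pole: "is_pole F z" and F_zorder: "zorder F z = -1" and F_residue: "residue F z = c j / (- a)"
proof -
  define D where "D w = 1 - \<mu> j * exp (a * w)" for w
  define G where "G w = (\<Sum>i\<in>J - {j}. c i / (1 - \<mu> i * exp (a * w))) + g w" for w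
  have F_split: "F w = c j / D w + G w" for w
    using fin j(1) by (simp add: F_def G_def D_def sum.remove)
  have "\<mu> i * exp (a * z) \<noteq> 1" if "i \<in> J - {j}" for i
    using that inj j by (metis DiffE exp_not_eq_zero inj_onD insertI1 mult_right_cancel)
  hence "G analytic_on {z}"
    unfolding G_def by (intro analytic_intros term_analytic g_analytic) auto
  then obtain e where "e > 0" and G: "G holomorphic_on ball z e"
    by (auto simp: analytic_on_def)
  define f where "f w = c j + G w * D w" for w
  have D: "D holomorphic_on S" for S unfolding D_def by (intro holomorphic_intros)
  have f: "f holomorphic_on ball z e" unfolding f_def by (intro holomorphic_intros G D)
  have D0: "D z = 0" using j(2) by (simp add: D_def)
  have D': "(D has_field_derivative - a) (at z)"
    unfolding D_def using j(2) by (auto intro!: derivative_eq_intros simp: mult_ac)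
  have "\<forall>\<^sub>F w in at z. D w \<noteq> 0 \<and> w \<in> UNIV"
  proof (rule non_zero_neighbour_alt [OF D])
    \<comment> \<open>Moving by \<open>ln 2 / a\<close> doubles the exponential, which gives a point
      where \<open>D\<close> is \<open>- 1\<close>. So \<open>D\<close> is not identically 0 and its
      zeros are isolated.\<close>
    have "exp (a * (z + of_real (ln 2) / a)) = 2 * exp (a * z)"
      using a by (simp add: distrib_left exp_add exp_of_real)
    hence "D (z + of_real (ln 2) / a) = - 1"
      using j(2) by (simp add: D_def mult.left_commute)
    thus "D (z + of_real (ln 2) / a) \<noteq> 0" by simp
  qed auto
  hence ev: "\<forall>\<^sub>F w in at z. f w / D w = F w"
    by eventually_elim (simp add: F_split f_def add_divide_distrib)
  have fz: "f z = c j" by (simp add: f_def D0)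
  have "is_pole (\<lambda>w. f w / D w) z"
  proof (rule is_pole_divide)
    show "isCont f z"
      using f \<open>e > 0\<close> holomorphic_on_imp_continuous_on continuous_on_interior by fastforce
    have "D \<midarrow>z\<rightarrow> 0"
      using DERIV_isCont [OF D'] D0 by (simp add: isCont_def)
    thus "filterlim D (at 0) (at z)"
      using \<open>\<forall>\<^sub>F w in at z. D w \<noteq> 0 \<and> w \<in> UNIV\<close> by (auto simp: filterlim_at elim: eventually_mono)
  qed (use fz \<open>c j \<noteq> 0\<close> in simp)
  thus "is_pole F z" using is_pole_cong [OF ev refl] by simp
  have "zorder (\<lambda>w. f w / D w) z = -1"
    by (rule porder_simple_pole_deriv [OF f D _ _ _ D']) (use \<open>e > 0\<close> \<open>c j \<noteq> 0\<close> fz D0 a in auto)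
  thus "zorder F z = -1" using zorder_cong [OF ev refl] by simp
  have "residue (\<lambda>w. f w / D w) z = f z / (- a)"
    by (rule residue_simple_pole_deriv [OF f D _ _ _ D']) (use \<open>e > 0\<close> \<open>c j \<noteq> 0\<close> fz D0 a in auto)
  thus "residue F z = c j / (- a)" using residue_cong [OF ev refl] fz by simp
qed

text \<open>Extends the residue formula to \<open>c j = 0\<close>: no other term is singular at
  \<open>z\<close>, so \<open>F\<close> is analytic there and both sides are 0.\<close>

lemma F_residue':
  assumes j: "j \<in> J" "\<mu> j * exp (a * z) = 1"
  shows "residue F z = c j / (- a)"
proof (cases "c j = 0")
  case True
  have "F analytic_on {z}"
  proof (rule F_analytic)
    fix i assume "i \<in> J" "c i \<noteq> 0"
    hence "\<mu> i \<noteq> \<mu> j" using True inj j(1) by (auto dest: inj_onD)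
    thus "\<mu> i * exp (a * z) \<noteq> 1" using j(2) by (metis exp_not_eq_zero mult_right_cancel)
  qed
  hence "residue F z = 0" by (auto simp: analytic_at intro: residue_holo)
  thus ?thesis using True by simp
qed (rule F_residue [OF j])

lemma F_pole_iff: "is_pole F z \<longleftrightarrow> (\<exists>j\<in>J. c j \<noteq> 0 \<and> \<mu> j * exp (a * z) = 1)"
  using F_pole F_analytic analytic_at_imp_no_pole by blast

lemma F_isolated: "isolated_singularity_at F z"
  using F_meromorphic [of "{z}"] by (auto intro: meromorphic_on_isolated_singularity)

end

lemma remove_sings_periodic:
  assumes "\<And>w. f (w + t) = f w"
  shows "remove_sings f (z + t) = remove_sings f z"
proof -
  have "f (z + t + w) = f (z + w)" for w
    using assms [of "z + w"] by (simp add: ac_simps)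
  thus ?thesis using remove_sings_shift_0 [of f "z + t"] remove_sings_shift_0 [of f z] by simp
qed

lemma mult_exp_eq_1_iff:
  fixes \<mu> :: complex and a :: real
  assumes "\<mu> \<noteq> 0" "a \<noteq> 0"
  shows "\<mu> * exp (of_real a * z) = 1 \<longleftrightarrow>
    (\<exists>k::int. z = (Ln \<mu> + 2 * of_real pi * \<i> * of_int k) / of_real (- a))"
proof -
  have "\<mu> * exp (of_real a * z) = exp (Ln \<mu> + of_real a * z)"
    using assms(1) by (simp add: exp_add)
  hence "\<mu> * exp (of_real a * z) = 1 \<longleftrightarrow> (\<exists>n::int. 0 = Ln \<mu> + of_real a * z + of_int (2 * n) * of_real pi * \<i>)"
    using exp_eq [of 0 "Ln \<mu> + of_real a * z"] by auto
  also have "\<dots> \<longleftrightarrow> (\<exists>k::int. z = (Ln \<mu> + 2 * of_real pi * \<i> * of_int k) / of_real (- a))"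
  proof (intro arg_cong [where f = Ex] ext)
    fix k :: int
    have "Ln \<mu> + of_real a * z + of_int (2 * k) * of_real pi * \<i> =
        Ln \<mu> + 2 * of_real pi * \<i> * of_int k - of_real (- a) * z"
      by (simp add: algebra_simps)
    hence "0 = Ln \<mu> + of_real a * z + of_int (2 * k) * of_real pi * \<i> \<longleftrightarrow>
      of_real (- a) * z = Ln \<mu> + 2 * of_real pi * \<i> * of_int k"
      by (metis right_minus_eq)
    also have "\<dots> \<longleftrightarrow> z = (Ln \<mu> + 2 * of_real pi * \<i> * of_int k) / of_real (- a)"
      using assms(2) by (subst nonzero_eq_divide_eq) (auto simp only: mult.commute of_real_eq_0_iff neg_equal_0_iff_equal)
    finally show "(0 = Ln \<mu> + of_real a * z + of_int (2 * k) * of_real pi * \<i>) =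
      (z = (Ln \<mu> + 2 * of_real pi * \<i> * of_int k) / of_real (- a))" .
  qed
  finally show ?thesis .
qed

section \<open>The zeta function\<close>

text \<open>Two different candidates would each be strictly smaller than the other.\<close>

lemma perron_frobenius_eigenvalue_eqI:
  assumes "r > 0" "complex_of_real r \<in> eigenvalues A"
    "\<And>\<mu>. \<lbrakk>\<mu> \<in> eigenvalues A; \<mu> \<noteq> complex_of_real r\<rbrakk> \<Longrightarrow> cmod \<mu> < r"
  shows "perron_frobenius_eigenvalue A = r"
  unfolding perron_frobenius_eigenvalue_def
proof (rule the_equality)
  fix l assume l: "l > 0 \<and> complex_of_real l \<in> eigenvalues A \<and>
    (\<forall>\<mu>\<in>eigenvalues A. \<mu> \<noteq> complex_of_real l \<longrightarrow> cmod \<mu> < l)"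
  show "l = r"
  proof (rule ccontr)
    assume "l \<noteq> r"
    hence "cmod (of_real l) < r" using l assms(3) [of "of_real l"] by simp
    moreover have "cmod (of_real r) < l" using \<open>l \<noteq> r\<close> l assms(2) by (metis of_real_eq_iff)
    ultimately show False using l \<open>r > 0\<close> by simp
  qed
qed (use assms in auto)

text \<open>A vanishing \<open>C j\<close> yields no pole, so the set of poles is restricted to
  nonzero \<open>C j\<close>, while the residue formula covers both cases. For empty
  \<open>H\<close> the trace is an empty sum that converges everywhere, hence the premise on
  \<open>H\<close> in the last clause.\<close>

theorem theorem3p4:
  fixes src rng :: "'e::finite \<Rightarrow> 'v::finite"
    and A :: "complex ^ 'v ^ 'v"
    and lstar :: 'e and tauhat :: "'e \<Rightarrow> 'e" and dst :: "'v \<Rightarrow> 'v \<Rightarrow> nat"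
    and H :: "('e \<times> 'e) set" and \<rho> lamPF s0 :: real
    and p :: nat and lam C :: "nat \<Rightarrow> complex" and M :: "nat \<Rightarrow> nat"
    and R L :: "nat \<Rightarrow> nat \<Rightarrow> complex ^ 'v"
  defines "A \<equiv> graph_matrix src rng"
    and "lamPF \<equiv> perron_frobenius_eigenvalue A"
    and "s0 \<equiv> ln lamPF / (- ln \<rho>)"
    and "M \<equiv> \<lambda>j. algebraic_multiplicity A (lam j)"
    and "C \<equiv> \<lambda>j. C_const src H (lam j) (M j) (R j) (L j)"
  assumes primitive: "primitive_matrix (graph_matrix src rng)"
    and lstar_loop: "src lstar = rng lstar"
    and dst: "dst = step_dist (steps src rng) \<or>
              dst = step_dist (steps src rng \<union> (steps src rng)\<inverse>)"
    and tauhat_lstar: "\<And>\<epsilon>. rng \<epsilon> = src lstar \<Longrightarrow> tauhat \<epsilon> = lstar"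
    and tauhat_closer: "\<And>\<epsilon>. rng \<epsilon> \<noteq> src lstar \<Longrightarrow>
          src (tauhat \<epsilon>) = rng \<epsilon> \<and>
          dst (rng (tauhat \<epsilon>)) (src lstar) < dst (rng \<epsilon>) (src lstar)"
    and H_subset: "H \<subseteq> {(\<epsilon>, \<epsilon>'). \<epsilon> \<noteq> \<epsilon>' \<and> src \<epsilon> = src \<epsilon>'}"
    and H_sym: "sym H"
    and rho: "0 < \<rho>" "\<rho> < 1"
    and diagonalizable: "diagonalizable_matrix A"
    and lam_eigenvalues: "lam ` {1..p} = eigenvalues A" "inj_on lam {1..p}"
    and lam_1: "lam 1 = complex_of_real lamPF"
    and R_basis: "\<And>j. j \<in> {1..p} \<Longrightarrow> indexed_basis_of (R j) (M j) (right_eigenspace A (lam j))"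
    and L_basis: "\<And>j. j \<in> {1..p} \<Longrightarrow> indexed_basis_of (L j) (M j) (left_eigenspace A (lam j))"
    and RL_normalized: "\<And>j l j' l'. \<lbrakk>j \<in> {1..p}; l \<in> {1..M j}; j' \<in> {1..p}; l' \<in> {1..M j'}\<rbrakk> \<Longrightarrow>
          (\<Sum>v\<in>UNIV. R j l $ v * L j' l' $ v) = (if j = j' \<and> l = l' then 1 else 0)"
  shows "\<exists>\<zeta> h :: complex \<Rightarrow> complex.
      \<zeta> nicely_meromorphic_on UNIV \<and>
      (\<forall>z. Re z > s0 \<longrightarrow>
         zeta_converges src rng tauhat H \<rho> z \<and> \<zeta> z = zeta_trace src rng tauhat H \<rho> z) \<and>
      (\<forall>z. \<zeta> (z + 2 * complex_of_real pi * \<i> / complex_of_real (ln \<rho>)) = \<zeta> z) \<and>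
      h holomorphic_on UNIV \<and>
      (\<forall>z. (\<forall>j\<in>{1..p}. lam j * complex_of_real \<rho> powr z \<noteq> 1) \<longrightarrow>
         \<zeta> z = (\<Sum>j=1..p. C j / (1 - lam j * complex_of_real \<rho> powr z)) + h z) \<and>
      {z. is_pole \<zeta> z} =
        {(Ln (lam j) + 2 * complex_of_real pi * \<i> * of_int k) / complex_of_real (- ln \<rho>) |j k.
           j \<in> {1..p} \<and> lam j \<noteq> 0 \<and> C j \<noteq> 0} \<and>
      (\<forall>z. is_pole \<zeta> z \<longrightarrow> zorder \<zeta> z = -1) \<and>
      (\<forall>j\<in>{1..p}. \<forall>k::int. lam j \<noteq> 0 \<longrightarrow>
         residue \<zeta> ((Ln (lam j) + 2 * complex_of_real pi * \<i> * of_int k) / complex_of_real (- ln \<rho>))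
           = C j / complex_of_real (- ln \<rho>)) \<and>
      (H \<noteq> {} \<longrightarrow> metric_dimension src rng tauhat H \<rho> = ereal s0)"
proof -
  interpret horizontal_edges src rng tauhat H \<rho>
    using H_subset H_sym rho by unfold_locales

  \<comment> \<open>Dominant eigenvalue and half-plane of convergence\<close>
  define B where "B = (graph_matrix src rng :: real ^ 'v ^ 'v)"
  have B: "B $ v $ w \<ge> 0" "primitive_matrix B" for v w
    using primitive by (simp_all add: B_def) (simp add: graph_matrix_def)
  have A_B: "A = (\<chi> i j. complex_of_real (B $ i $ j))"
    by (simp add: A_def B_def graph_matrix_def vec_eq_iff)
  have fin: "finite (eigenvalues A)"
    using lam_eigenvalues(1) by (metis finite_atLeastAtMost finite_imageI)
  obtain r :: real and y :: "real ^ 'v" where r: "r > 0" "complex_of_real r \<in> eigenvalues A"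
    and dom: "\<And>\<mu>. \<lbrakk>\<mu> \<in> eigenvalues A; \<mu> \<noteq> complex_of_real r\<rbrakk> \<Longrightarrow> cmod \<mu> < r"
    and y: "\<And>v. y $ v > 0" "B *v y = r *s y"
    by (rule diagonalizable_perron_frobenius [OF B, folded A_B, OF diagonalizable fin]) (rule that)
  have lamPF: "lamPF = r"
    unfolding lamPF_def by (rule perron_frobenius_eigenvalue_eqI [OF r dom])
  have lam_le: "cmod (lam j) \<le> r" if "j \<in> {1..p}" for j
  proof -
    have "lam j \<in> eigenvalues A" using that lam_eigenvalues(1) by blast
    thus ?thesis using dom [of "lam j"] r(1) by (cases "lam j = of_real r") auto
  qed
  define a where "a = ln \<rho>"
  have a: "a < 0" unfolding a_def using rho by simp
  define u where "u z = exp (complex_of_real a * z)" for z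
  have powr_u: "complex_of_real \<rho> powr z = u z" for z
    by (simp add: of_real_pos_cpowr [OF rho(1)] u_def a_def mult.commute)
  have norm_u: "cmod (u z) = exp (a * Re z)" for z by (simp add: u_def)
  \<comment> \<open>The abscissa is the place where the ratio of the dominant geometric series
    crosses 1.\<close>
  have s0: "s0 < x \<longleftrightarrow> r * exp (a * x) < 1" for x
  proof -
    have "r * exp (a * x) < 1 \<longleftrightarrow> exp (ln r + a * x) < exp 0"
      using r(1) by (simp add: exp_add)
    also have "\<dots> \<longleftrightarrow> ln r < x * (- a)" by (simp add: algebra_simps) linarith
    also have "\<dots> \<longleftrightarrow> s0 < x"
      unfolding s0_def lamPF a_def [symmetric] using a by (subst pos_divide_less_eq) auto
    finally show ?thesis by simp
  qed

  \<comment> \<open>Spectral formula for the number of edges of each level\<close>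
  define K where "K j = (\<Sum>l=1..M j. \<Sum>v\<in>UNIV. \<Sum>h\<in>H. R j l $ v * L j l $ src (fst h))" for j
  have C_K: "C j = 1 / lam j * K j" for j by (simp add: C_def C_const_def K_def)
  have eig: "graph_matrix src rng *v R j l = lam j *s R j l" if "j \<in> {1..p}" "l \<in> {1..M j}" for j l
  proof -
    have "R j l \<in> vec.span (R j ` {1..M j})" using that by (intro vec.span_base) auto
    thus ?thesis
      using R_basis [OF that(1)] by (simp add: indexed_basis_of_def right_eigenspace_def A_def)
  qed
  have resolution: "(\<Sum>j=1..p. \<Sum>l=1..M j. R j l $ v * L j l $ w) = (if v = w then 1 else 0)" for v w
  proof (rule biorthogonal_resolution [OF diagonalizable])
    show "eigenvalues A \<subseteq> lam ` {1..p}" using lam_eigenvalues(1) by simp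
    show "right_eigenspace A (lam j) \<subseteq> vec.span (R j ` {1..M j})" if "j \<in> {1..p}" for j
      using R_basis [OF that] by (simp add: indexed_basis_of_def)
  qed (use RL_normalized in auto)
  \<comment> \<open>Since \<open>0 ^ 0 = 1\<close>, a zero eigenvalue contributes to
    \<open>m = 0\<close> only, that is, to level 1.\<close>
  have card_E: "of_nat (card (E' m)) = (\<Sum>j=1..p. lam j ^ m * K j)" for m
  proof -
    have "of_nat (card (E' m)) = (\<Sum>h\<in>H. \<Sum>j=1..p. lam j ^ m *
        (\<Sum>l=1..M j. \<Sum>v\<in>UNIV. R j l $ v * L j l $ src (fst h)))"
      using card_paths_to_spectral [OF eig resolution] by (simp add: card_E_level)
    also have "\<dots> = (\<Sum>j=1..p. lam j ^ m *
        (\<Sum>h\<in>H. \<Sum>l=1..M j. \<Sum>v\<in>UNIV. R j l $ v * L j l $ src (fst h)))"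
      by (subst sum.swap) (simp add: sum_distrib_left)
    also have "\<dots> = (\<Sum>j=1..p. lam j ^ m * K j)"
      unfolding K_def
      by (rule sum.cong [OF refl], rule arg_cong [where f = "(*) _"], subst sum.swap,
          intro sum.cong refl, rule sum.swap)
    finally show ?thesis .
  qed

  \<comment> \<open>Meromorphic continuation\<close>
  define h where "h z = (\<Sum>j=1..p. if lam j = 0 then K j * u z else - C j)" for z
  have h_holo: "h holomorphic_on UNIV"
  proof -
    have "(\<lambda>z. if lam j = 0 then K j * u z else - C j) holomorphic_on UNIV" for j
      unfolding u_def by (cases "lam j = 0") (auto intro!: holomorphic_intros)
    thus ?thesis unfolding h_def by (intro holomorphic_intros)
  qed
  interpret P: exponential_poles "{1..p}" lam C "complex_of_real a" h
    using lam_eigenvalues(2) a h_holo by unfold_locales auto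
  have F: "P.F z = (\<Sum>j=1..p. C j / (1 - lam j * u z)) + h z" for z
    by (simp only: P.F_def u_def)
  have series: "((\<lambda>m. of_nat (card (E' m)) * u z ^ Suc m) has_sum P.F z) UNIV"
    if less: "\<And>j. j \<in> {1..p} \<Longrightarrow> cmod (lam j * u z) < 1" for z
  proof -
    have "((\<lambda>m. \<Sum>j=1..p. (K j * u z) * (lam j * u z) ^ m) has_sum
        (\<Sum>j=1..p. (K j * u z) / (1 - lam j * u z))) UNIV"
      by (rule has_sum_exponential_sum) (use less in auto)
    also have "(\<lambda>m. \<Sum>j=1..p. (K j * u z) * (lam j * u z) ^ m) = (\<lambda>m. of_nat (card (E' m)) * u z ^ Suc m)"
      by (simp add: card_E sum_distrib_left sum_distrib_right power_mult_distrib mult_ac)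
    also have "(\<Sum>j=1..p. (K j * u z) / (1 - lam j * u z)) = P.F z"
      unfolding F h_def sum.distrib [symmetric]
    proof (rule sum.cong)
      fix j assume "j \<in> {1..p}"
      hence "lam j * u z \<noteq> 1" using less by fastforce
      \<comment> \<open>For \<open>lam j = 0\<close> the convention \<open>1 / 0 = 0\<close> makes
        \<open>C j\<close> vanish and leaves \<open>K j * u z\<close>; otherwise
        \<open>K j = lam j * C j\<close> splits off the constant \<open>- C j\<close>.\<close>
      thus "K j * u z / (1 - lam j * u z) =
          C j / (1 - lam j * u z) + (if lam j = 0 then K j * u z else - C j)"
        by (simp add: C_K field_simps)
    qed simp
    finally show ?thesis .
  qed
  have C_imp_lam: "C j \<noteq> 0 \<Longrightarrow> lam j \<noteq> 0" for j by (auto simp: C_K)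
  \<comment> \<open>Where a denominator vanishes, \<open>P.F\<close> has a value that comes from
    division by 0. Resetting it to 0 at poles gives a nicely meromorphic function that agrees with
    \<open>P.F\<close> at points of analyticity.\<close>
  define \<zeta> where "\<zeta> = remove_sings P.F"
  have \<zeta>_eq: "\<zeta> z = P.F z" if "\<And>j. j \<in> {1..p} \<Longrightarrow> lam j * u z \<noteq> 1" for z
    unfolding \<zeta>_def using that by (intro remove_sings_at_analytic P.F_analytic) (auto simp: u_def)
  have location: "lam j * u z = 1 \<longleftrightarrow>
      (\<exists>k::int. z = (Ln (lam j) + 2 * complex_of_real pi * \<i> * of_int k) / complex_of_real (- ln \<rho>))"
    if "lam j \<noteq> 0" for j z
    using mult_exp_eq_1_iff [OF that, of a z] a by (simp add: u_def a_def)
  have convergence: "zeta_converges src rng tauhat H \<rho> z \<and> \<zeta> z = zeta_trace src rng tauhat H \<rho> z"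
    if "Re z > s0" for z
  proof -
    have less: "cmod (lam j * u z) < 1" if "j \<in> {1..p}" for j
    proof -
      have "cmod (lam j * u z) \<le> r * exp (a * Re z)"
        using lam_le [OF that] by (simp add: norm_mult norm_u)
      also have "\<dots> < 1" using s0 \<open>Re z > s0\<close> by blast
      finally show ?thesis .
    qed
    have "\<zeta> z = P.F z" using less by (intro \<zeta>_eq) fastforce
    thus ?thesis using zeta_series [of z "P.F z"] series [OF less] unfolding powr_u by simp
  qed
  have periodic: "\<zeta> (z + 2 * complex_of_real pi * \<i> / complex_of_real (ln \<rho>)) = \<zeta> z" for z
  proof -
    \<comment> \<open>Both the fractions and \<open>h\<close> depend on the point only through
      \<open>u\<close>, and the shift multiplies \<open>u\<close> by the exponential of
      \<open>2 * pi * \<i>\<close>.\<close>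
    have "u (w + 2 * complex_of_real pi * \<i> / complex_of_real (ln \<rho>)) = u w" for w
      using a by (simp add: u_def a_def [symmetric] distrib_left exp_add mult.commute)
    thus ?thesis unfolding \<zeta>_def by (intro remove_sings_periodic) (simp only: F h_def)
  qed

  \<comment> \<open>Poles and residues\<close>
  have poles: "{z. is_pole \<zeta> z} =
      {(Ln (lam j) + 2 * complex_of_real pi * \<i> * of_int k) / complex_of_real (- ln \<rho>) |j k.
         j \<in> {1..p} \<and> lam j \<noteq> 0 \<and> C j \<noteq> 0}"
  proof -
    have "is_pole \<zeta> z \<longleftrightarrow> (\<exists>j\<in>{1..p}. C j \<noteq> 0 \<and> lam j * u z = 1)" for z
      unfolding \<zeta>_def is_pole_remove_sings_iff [OF P.F_isolated] u_def by (rule P.F_pole_iff)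
    also have "\<dots> z \<longleftrightarrow> (\<exists>j\<in>{1..p}. C j \<noteq> 0 \<and> lam j \<noteq> 0 \<and> (\<exists>k::int.
        z = (Ln (lam j) + 2 * complex_of_real pi * \<i> * of_int k) / complex_of_real (- ln \<rho>)))" for z
      by (intro bex_cong refl conj_cong) (use location C_imp_lam in blast)
    also have "\<dots> z \<longleftrightarrow> (\<exists>j k. z = (Ln (lam j) + 2 * complex_of_real pi * \<i> * of_int k) /
        complex_of_real (- ln \<rho>) \<and> j \<in> {1..p} \<and> lam j \<noteq> 0 \<and> C j \<noteq> 0)" for z
      by blast
    finally show ?thesis by (intro Collect_cong)
  qed
  have simple: "zorder \<zeta> z = -1" if "is_pole \<zeta> z" for z
    using that P.F_zorder
    unfolding \<zeta>_def is_pole_remove_sings_iff [OF P.F_isolated] zorder_remove_sings [OF P.F_isolated]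
      P.F_pole_iff by blast
  have residues: "residue \<zeta> ((Ln (lam j) + 2 * complex_of_real pi * \<i> * of_int k) / complex_of_real (- ln \<rho>))
      = C j / complex_of_real (- ln \<rho>)" if "j \<in> {1..p}" "lam j \<noteq> 0" for j and k :: int
  proof -
    have "lam j * exp (of_real a * ((Ln (lam j) + 2 * complex_of_real pi * \<i> * of_int k) /
        complex_of_real (- ln \<rho>))) = 1"
      using location [OF that(2)] unfolding u_def by blast
    from P.F_residue' [OF that(1) this] show ?thesis
      unfolding \<zeta>_def residue_remove_sings [OF P.F_isolated] a_def [symmetric]
      by (simp only: of_real_minus)
  qed

  \<comment> \<open>Abscissa of convergence\<close>
  have dimension: "metric_dimension src rng tauhat H \<rho> = ereal s0" if "H \<noteq> {}"
  proof -
    obtain h0 where h0: "h0 \<in> H" using \<open>H \<noteq> {}\<close> by blast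
    obtain c k where "c > 0" and growth: "\<And>m w. c * r ^ m \<le> real (card (paths_to src rng (m + k) w))"
      using card_paths_to_lower_bound [of src rng y r] primitive y r(1) unfolding B_def by blast
    have le: "s0 \<le> Re z" if conv: "zeta_converges src rng tauhat H \<rho> z" for z
    proof (rule ccontr)
      assume "\<not> s0 \<le> Re z"
      define Q where "Q = cmod (u z)"
      \<comment> \<open>At \<open>x\<close> the ratio \<open>r * exp (a * x)\<close> is at least 1;
        moving further left to \<open>Re z\<close> makes it strictly larger, because
        \<open>a < 0\<close>.\<close>
      obtain x where x: "Re z < x" "x < s0" using \<open>\<not> s0 \<le> Re z\<close> dense [of "Re z" s0] by auto
      have "1 \<le> r * exp (a * x)" using s0 [of x] x(2) by linarith
      also have "\<dots> < r * Q" using r(1) a x(1) by (simp add: Q_def norm_u)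
      finally have "r * Q > 1" .
      have "Q > 0" by (simp add: Q_def norm_u)
      obtain K where K: "\<And>m. real (card (E' m)) * Q ^ Suc m \<le> K"
        using zeta_converges_imp_bounded [OF conv] unfolding Q_def powr_u by blast
      \<comment> \<open>Chosen so that the term of level \<open>m + k + 1\<close> exceeds the bound
        \<open>K\<close>; the lower bound on paths only starts \<open>k\<close> steps later.\<close>
      obtain m where m: "K / (c * Q ^ Suc k) < (r * Q) ^ m"
        using real_arch_pow [OF \<open>r * Q > 1\<close>] by blast
      have "c * r ^ m \<le> real (card (paths_to src rng (m + k) (src (fst h0))))" by (rule growth)
      also have "\<dots> \<le> real (card (E' (m + k)))"
        unfolding card_E_level of_nat_le_iff using h0 by (intro member_le_sum) auto
      finally have "c * r ^ m * Q ^ Suc (m + k) \<le> real (card (E' (m + k))) * Q ^ Suc (m + k)"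
        using \<open>Q > 0\<close> by (intro mult_right_mono) auto
      also have "\<dots> \<le> K" by (rule K)
      finally have "(r * Q) ^ m * (c * Q ^ Suc k) \<le> K"
        by (simp add: power_mult_distrib power_add mult_ac)
      moreover have "c * Q ^ Suc k > 0" using \<open>c > 0\<close> \<open>Q > 0\<close> by simp
      ultimately show False using m by (simp add: pos_divide_less_eq)
    qed
    show ?thesis unfolding metric_dimension_def
    proof (rule antisym)
      show "ereal s0 \<le> Inf {ereal (Re z) |z. zeta_converges src rng tauhat H \<rho> z}"
        using le by (intro Inf_greatest) auto
      show "Inf {ereal (Re z) |z. zeta_converges src rng tauhat H \<rho> z} \<le> ereal s0"
      proof (rule ccontr)
        assume "\<not> ?thesis"
        hence "ereal s0 < Inf {ereal (Re z) |z. zeta_converges src rng tauhat H \<rho> z}"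
          by (simp only: not_le)
        \<comment> \<open>A real number strictly between \<open>s0\<close> and the infimum would be
          a point of convergence below the infimum.\<close>
        from ereal_dense2 [OF this] obtain x where x: "ereal s0 < ereal x"
          "ereal x < Inf {ereal (Re z) |z. zeta_converges src rng tauhat H \<rho> z}"
          by blast
        hence "zeta_converges src rng tauhat H \<rho> (of_real x)" using convergence by simp
        hence "Inf {ereal (Re z) |z. zeta_converges src rng tauhat H \<rho> z} \<le> ereal x"
          by (intro Inf_lower) force
        thus False using x(2) by simp
      qed
    qed
  qed
  show ?thesis
  proof (rule exI [of _ \<zeta>], rule exI [of _ h], intro conjI)
    show "\<zeta> nicely_meromorphic_on UNIV"
      unfolding \<zeta>_def by (rule remove_sings_nicely_meromorphic [OF P.F_meromorphic])
    show "\<forall>z. (\<forall>j\<in>{1..p}. lam j * complex_of_real \<rho> powr z \<noteq> 1) \<longrightarrow>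
         \<zeta> z = (\<Sum>j=1..p. C j / (1 - lam j * complex_of_real \<rho> powr z)) + h z"
      unfolding powr_u using \<zeta>_eq F by auto
  qed (use convergence periodic h_holo poles simple residues dimension in blast)+
qed

end
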